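(* The category $\mathcal{C}$ of boron trees and embeddings, regarded as an $\mathbf{FI}$-concrete category via $|T|=T_H$, is a QG-category.
   Context: A boron tree is a finite (non-empty) tree in which every internal vertex has valence three (the trees with one or two vertices are allowed). The leaves are called hydrogen atoms (the vertex of a one-vertex tree is counted as a hydrogen atom), and $T_H$ denotes the set of hydrogen atoms of $T$. It carries a quaternary relation $\rho$: $\rho(w,x;y,z)$ holds if the geodesic (path in the tree, including endpoints) joining $w$ and $x$ intersects the geodesic joining $y$ and $z$. A morphism $T\to T'$ in $\mathcal{C}$ (an embedding) is an injective map $T_H\to T'_H$ preserving and reflecting $\rho$. $\mathbf{FI}$ is the category of finite sets and injections. A functor is conservative if it reflects isomorphisms. An $\mathbf{FI}$-concrete category is a category $\mathcal{E}$ equipped with a faithful conservative functor $|\cdot|\colon\mathcal{E}\to\mathbf{FI}$. A concrete functor $\Phi\colon\mathcal{E}\to\mathcal{E}'$ is a functor equipped with a natural isomorphism $|A|\to|\Phi(A)|$. A weighting on an object $A$ of $\mathcal{E}$ is a function $\alpha\colon|A|\to\mathbf{N}$ (with $0\in\mathbf{N}$). A weighted object is a pair $(A,\alpha)$; a morphism $(A,\alpha)\to(B,\beta)$ is a morphism $\phi\colon A\to B$ in $\mathcal{E}$ with $\alpha(x)\le\beta(\phi(x))$ for all $x\in|A|$. $\mathcal{M}(\mathcal{E})$ is the set of isomorphism classes $[A,\alpha]$ of weighted objects, partially ordered by $[A,\alpha]\le[B,\beta]$ if there is a morphism $(A,\alpha)\to(B,\beta)$. $\mathcal{E}$ is orderable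 if one can assign to each object $A$ a total order on $|A|$ such that $|\phi|$ is order-preserving for every morphism $\phi$. wqo means well-quasi-order (every infinite sequence $x_1,x_2,\dots$ has $i<j$ with $x_i\le x_j$). A G-category is an $\mathbf{FI}$-concrete category $\mathcal{E}$ that is orderable and for which $\mathcal{M}(\mathcal{E})$ is wqo. A QG-category is an $\mathbf{FI}$-concrete category $\mathcal{E}$ for which there exists a G-category $\mathcal{D}$ and a concrete functor $\mathcal{D}\to\mathcal{E}$ that is essentially surjective. *)

theory Defs
  imports "HOL-Library.FuncSet" "HOL-Library.Infinite_Typeclass"
begin

section \<open>Categories and functors\<close>

text \<open>
  Hom-sets need not be disjoint, so composition and the action of a functor on morphisms take the
  source and target objects as arguments: \<open>Comp \<C> A B C g f\<close> is \<open>g \<circ> f\<close> for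
  \<open>f : A \<rightarrow> B\<close> and \<open>g : B \<rightarrow> C\<close>.
\<close>

record ('o, 'm) category =
  Ob :: "'o set"
  Hom :: "'o \<Rightarrow> 'o \<Rightarrow> 'm set"
  Ident :: "'o \<Rightarrow> 'm"
  Comp :: "'o \<Rightarrow> 'o \<Rightarrow> 'o \<Rightarrow> 'm \<Rightarrow> 'm \<Rightarrow> 'm"

definition is_category :: "('o, 'm) category \<Rightarrow> bool" where
  "is_category \<C> \<longleftrightarrow>
     (\<forall>A\<in>Ob \<C>. Ident \<C> A \<in> Hom \<C> A A) \<and>
     (\<forall>A\<in>Ob \<C>. \<forall>B\<in>Ob \<C>. \<forall>C\<in>Ob \<C>. \<forall>f\<in>Hom \<C> A B. \<forall>g\<in>Hom \<C> B C.
        Comp \<C> A B C g f \<in> Hom \<C> A C) \<and>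
     (\<forall>A\<in>Ob \<C>. \<forall>B\<in>Ob \<C>. \<forall>f\<in>Hom \<C> A B.
        Comp \<C> A A B f (Ident \<C> A) = f \<and> Comp \<C> A B B (Ident \<C> B) f = f) \<and>
     (\<forall>A\<in>Ob \<C>. \<forall>B\<in>Ob \<C>. \<forall>C\<in>Ob \<C>. \<forall>D\<in>Ob \<C>.
        \<forall>f\<in>Hom \<C> A B. \<forall>g\<in>Hom \<C> B C. \<forall>h\<in>Hom \<C> C D.
          Comp \<C> A C D h (Comp \<C> A B C g f) = Comp \<C> A B D (Comp \<C> B C D h g) f)"

definition is_iso :: "('o, 'm) category \<Rightarrow> 'o \<Rightarrow> 'o \<Rightarrow> 'm \<Rightarrow> bool" where
  "is_iso \<C> A B f \<longleftrightarrow> f \<in> Hom \<C> A B \<and>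
     (\<exists>g\<in>Hom \<C> B A. Comp \<C> A B A g f = Ident \<C> A \<and> Comp \<C> B A B f g = Ident \<C> B)"

definition isomorphic :: "('o, 'm) category \<Rightarrow> 'o \<Rightarrow> 'o \<Rightarrow> bool" where
  "isomorphic \<C> A B \<longleftrightarrow> (\<exists>f. is_iso \<C> A B f)"

record ('o, 'm, 'p, 'n) functr =
  obj_map :: "'o \<Rightarrow> 'p"
  mor_map :: "'o \<Rightarrow> 'o \<Rightarrow> 'm \<Rightarrow> 'n"

definition is_functor ::
  "('o, 'm) category \<Rightarrow> ('p, 'n) category \<Rightarrow> ('o, 'm, 'p, 'n) functr \<Rightarrow> bool" where
  "is_functor \<C> \<D> F \<longleftrightarrow>
     (\<forall>A\<in>Ob \<C>. obj_map F A \<in> Ob \<D>) \<and>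
     (\<forall>A\<in>Ob \<C>. \<forall>B\<in>Ob \<C>. \<forall>f\<in>Hom \<C> A B.
        mor_map F A B f \<in> Hom \<D> (obj_map F A) (obj_map F B)) \<and>
     (\<forall>A\<in>Ob \<C>. mor_map F A A (Ident \<C> A) = Ident \<D> (obj_map F A)) \<and>
     (\<forall>A\<in>Ob \<C>. \<forall>B\<in>Ob \<C>. \<forall>C\<in>Ob \<C>. \<forall>f\<in>Hom \<C> A B. \<forall>g\<in>Hom \<C> B C.
        mor_map F A C (Comp \<C> A B C g f) =
          Comp \<D> (obj_map F A) (obj_map F B) (obj_map F C) (mor_map F B C g) (mor_map F A B f))"

definition faithful :: "('o, 'm) category \<Rightarrow> ('o, 'm, 'p, 'n) functr \<Rightarrow> bool" where
  "faithful \<C> F \<longleftrightarrow> (\<forall>A\<in>Ob \<C>. \<forall>B\<in>Ob \<C>. inj_on (mor_map F A B) (Hom \<C> A B))"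

definition conservative ::
  "('o, 'm) category \<Rightarrow> ('p, 'n) category \<Rightarrow> ('o, 'm, 'p, 'n) functr \<Rightarrow> bool" where
  "conservative \<C> \<D> F \<longleftrightarrow>
     (\<forall>A\<in>Ob \<C>. \<forall>B\<in>Ob \<C>. \<forall>f\<in>Hom \<C> A B.
        is_iso \<D> (obj_map F A) (obj_map F B) (mor_map F A B f) \<longrightarrow> is_iso \<C> A B f)"

definition essentially_surjective ::
  "('o, 'm) category \<Rightarrow> ('p, 'n) category \<Rightarrow> ('o, 'm, 'p, 'n) functr \<Rightarrow> bool" where
  "essentially_surjective \<C> \<D> F \<longleftrightarrow>
     (\<forall>B\<in>Ob \<D>. \<exists>A\<in>Ob \<C>. isomorphic \<D> (obj_map F A) B)"


section \<open>\<open>FI\<close>-concrete categories\<close>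

text \<open>Finite subsets of the type \<open>'x\<close>, with injections represented as extensional functions.\<close>

definition FI :: "('x set, 'x \<Rightarrow> 'x) category" where
  "FI = \<lparr> Ob = {X. finite X},
          Hom = (\<lambda>X Y. {f \<in> X \<rightarrow>\<^sub>E Y. inj_on f X}),
          Ident = (\<lambda>X. \<lambda>x\<in>X. x),
          Comp = (\<lambda>X Y Z g f. compose X g f) \<rparr>"

type_synonym ('o, 'm, 'x) to_FI = "('o, 'm, 'x set, 'x \<Rightarrow> 'x) functr"

definition FI_concrete :: "('o, 'm) category \<Rightarrow> ('o, 'm, 'x) to_FI \<Rightarrow> bool" where
  "FI_concrete \<E> U \<longleftrightarrow>
     is_category \<E> \<and> is_functor \<E> FI U \<and> faithful \<E> U \<and> conservative \<E> FI U"

text \<open>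
  The two underlying-set functors may take values in subsets of different types, so the components
  \<open>|A| \<rightarrow> |\<Phi>(A)|\<close> of the natural isomorphism are given as bijections.
\<close>

definition concrete_functor ::
  "('o, 'm) category \<Rightarrow> ('o, 'm, 'x) to_FI \<Rightarrow> ('p, 'n) category \<Rightarrow> ('p, 'n, 'y) to_FI \<Rightarrow>
   ('o, 'm, 'p, 'n) functr \<Rightarrow> ('o \<Rightarrow> 'x \<Rightarrow> 'y) \<Rightarrow> bool" where
  "concrete_functor \<D> V \<E> U \<Phi> \<eta> \<longleftrightarrow>
     is_functor \<D> \<E> \<Phi> \<and>
     (\<forall>A\<in>Ob \<D>. bij_betw (\<eta> A) (obj_map V A) (obj_map U (obj_map \<Phi> A))) \<and>
     (\<forall>A\<in>Ob \<D>. \<forall>B\<in>Ob \<D>. \<forall>f\<in>Hom \<D> A B. \<forall>x\<in>obj_map V A.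
        \<eta> B (mor_map V A B f x) =
          mor_map U (obj_map \<Phi> A) (obj_map \<Phi> B) (mor_map \<Phi> A B f) (\<eta> A x))"


section \<open>Weighted objects\<close>

text \<open>A weighting on \<open>A\<close> is made a total function by extensionality outside \<open>|A|\<close>.\<close>

definition weighted ::
  "('o, 'm) category \<Rightarrow> ('o, 'm, 'x) to_FI \<Rightarrow> ('o \<times> ('x \<Rightarrow> nat), 'm) category" where
  "weighted \<E> U =
     \<lparr> Ob = {(A, \<alpha>). A \<in> Ob \<E> \<and> \<alpha> \<in> extensional (obj_map U A)},
       Hom = (\<lambda>(A, \<alpha>) (B, \<beta>).
         {f \<in> Hom \<E> A B. \<forall>x\<in>obj_map U A. \<alpha> x \<le> \<beta> (mor_map U A B f x)}),
       Ident = (\<lambda>(A, \<alpha>). Ident \<E> A),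
       Comp = (\<lambda>(A, \<alpha>) (B, \<beta>) (C, \<gamma>). Comp \<E> A B C) \<rparr>"

definition weighted_classes ::
  "('o, 'm) category \<Rightarrow> ('o, 'm, 'x) to_FI \<Rightarrow> ('o \<times> ('x \<Rightarrow> nat)) set set" where
  "weighted_classes \<E> U =
     (let W = weighted \<E> U
      in Ob W // {(a, b). a \<in> Ob W \<and> b \<in> Ob W \<and> isomorphic W a b})"

text \<open>By composing with isomorphisms, the choice of representatives is irrelevant.\<close>

definition weighted_le ::
  "('o, 'm) category \<Rightarrow> ('o, 'm, 'x) to_FI \<Rightarrow>
   ('o \<times> ('x \<Rightarrow> nat)) set \<Rightarrow> ('o \<times> ('x \<Rightarrow> nat)) set \<Rightarrow> bool" where
  "weighted_le \<E> U X Y \<longleftrightarrow> (\<exists>a\<in>X. \<exists>b\<in>Y. Hom (weighted \<E> U) a b \<noteq> {})"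

definition wqo_on :: "('a \<Rightarrow> 'a \<Rightarrow> bool) \<Rightarrow> 'a set \<Rightarrow> bool" where
  "wqo_on le X \<longleftrightarrow> reflp_on X le \<and> transp_on X le \<and>
     (\<forall>s :: nat \<Rightarrow> 'a. range s \<subseteq> X \<longrightarrow> (\<exists>i j. i < j \<and> le (s i) (s j)))"


section \<open>G-categories and QG-categories\<close>

definition orderable :: "('o, 'm) category \<Rightarrow> ('o, 'm, 'x) to_FI \<Rightarrow> bool" where
  "orderable \<E> U \<longleftrightarrow>
     (\<exists>r. (\<forall>A\<in>Ob \<E>. linear_order_on (obj_map U A) (r A)) \<and>
          (\<forall>A\<in>Ob \<E>. \<forall>B\<in>Ob \<E>. \<forall>f\<in>Hom \<E> A B. \<forall>(x, y)\<in>r A.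
             (mor_map U A B f x, mor_map U A B f y) \<in> r B))"

definition G_category :: "('o, 'm) category \<Rightarrow> ('o, 'm, 'x) to_FI \<Rightarrow> bool" where
  "G_category \<E> U \<longleftrightarrow>
     FI_concrete \<E> U \<and> orderable \<E> U \<and> wqo_on (weighted_le \<E> U) (weighted_classes \<E> U)"

text \<open>
  HOL cannot quantify over the types of objects, morphisms and underlying elements of the
  G-category \<open>\<D>\<close>; taking all three to be \<^typ>\<open>nat\<close> loses no generality. Indeed, in any
  G-category two objects with equipotent underlying sets and a morphism between them are isomorphic
  (the morphism is bijective on underlying sets, and the underlying-set functor is conservative),
  so by the wqo property, applied to zero weightings, there are only finitely many isomorphism
  classes of objects with an underlying set of a given size. Hence a skeleton of a G-category has
  countably many objects, and its hom-sets are finite by faithfulness. So it is isomorphic to a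
  category whose objects, morphisms and elements are natural numbers, and it inherits the
  G-category structure and any essentially surjective concrete functor.
\<close>

definition QG_category :: "('o, 'm) category \<Rightarrow> ('o, 'm, 'x) to_FI \<Rightarrow> bool" where
  "QG_category \<E> U \<longleftrightarrow>
     FI_concrete \<E> U \<and>
     (\<exists>(\<D> :: (nat, nat) category) (V :: (nat, nat, nat) to_FI) \<Phi> \<eta>.
        G_category \<D> V \<and> concrete_functor \<D> V \<E> U \<Phi> \<eta> \<and> essentially_surjective \<D> \<E> \<Phi>)"


section \<open>Boron trees\<close>

record 'v sgraph =
  verts :: "'v set"
  edges :: "'v set set"

definition is_path :: "'v sgraph \<Rightarrow> 'v \<Rightarrow> 'v list \<Rightarrow> 'v \<Rightarrow> bool" where
  "is_path T u p v \<longleftrightarrow>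
     p \<noteq> [] \<and> hd p = u \<and> last p = v \<and> distinct p \<and> set p \<subseteq> verts T \<and>
     successively (\<lambda>x y. {x, y} \<in> edges T) p"

definition is_cycle :: "'v sgraph \<Rightarrow> 'v list \<Rightarrow> bool" where
  "is_cycle T p \<longleftrightarrow>
     3 \<le> length p \<and> distinct p \<and> successively (\<lambda>x y. {x, y} \<in> edges T) p \<and>
     {last p, hd p} \<in> edges T"

definition finite_tree :: "'v sgraph \<Rightarrow> bool" where
  "finite_tree T \<longleftrightarrow>
     finite (verts T) \<and> verts T \<noteq> {} \<and>
     (\<forall>e\<in>edges T. e \<subseteq> verts T \<and> card e = 2) \<and>
     (\<forall>u\<in>verts T. \<forall>v\<in>verts T. \<exists>p. is_path T u p v) \<and>
     (\<nexists>p. is_cycle T p)"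

definition valence :: "'v sgraph \<Rightarrow> 'v \<Rightarrow> nat" where
  "valence T v = card {e \<in> edges T. v \<in> e}"

definition hydrogens :: "'v sgraph \<Rightarrow> 'v set" where
  "hydrogens T = {v \<in> verts T. valence T v = 1 \<or> verts T = {v}}"

definition boron_tree :: "'v sgraph \<Rightarrow> bool" where
  "boron_tree T \<longleftrightarrow> finite_tree T \<and> (\<forall>v\<in>verts T - hydrogens T. valence T v = 3)"

text \<open>The vertices on the geodesic from \<open>u\<close> to \<open>v\<close>; in a tree the path \<open>p\<close> is unique.\<close>

definition geodesic :: "'v sgraph \<Rightarrow> 'v \<Rightarrow> 'v \<Rightarrow> 'v set" where
  "geodesic T u v = {x. \<exists>p. is_path T u p v \<and> x \<in> set p}"

definition rho :: "'v sgraph \<Rightarrow> 'v \<Rightarrow> 'v \<Rightarrow> 'v \<Rightarrow> 'v \<Rightarrow> bool" where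
  "rho T w x y z \<longleftrightarrow> geodesic T w x \<inter> geodesic T y z \<noteq> {}"

text \<open>
  When \<open>'v\<close> is infinite, every finite tree has an isomorphic copy with vertices in \<open>'v\<close>, so
  this is then equivalent to the category of all boron trees.
\<close>

definition boron_category :: "('v sgraph, 'v \<Rightarrow> 'v) category" where
  "boron_category =
     \<lparr> Ob = {T. boron_tree T},
       Hom = (\<lambda>T T'. {f \<in> hydrogens T \<rightarrow>\<^sub>E hydrogens T'. inj_on f (hydrogens T) \<and>
         (\<forall>w\<in>hydrogens T. \<forall>x\<in>hydrogens T. \<forall>y\<in>hydrogens T. \<forall>z\<in>hydrogens T.
            rho T w x y z \<longleftrightarrow> rho T' (f w) (f x) (f y) (f z))}),
       Ident = (\<lambda>T. \<lambda>x\<in>hydrogens T. x),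
       Comp = (\<lambda>T T' T'' g f. compose (hydrogens T) g f) \<rparr>"

definition hydrogen_functor :: "('v sgraph, 'v \<Rightarrow> 'v, 'v) to_FI" where
  "hydrogen_functor = \<lparr> obj_map = hydrogens, mor_map = (\<lambda>T T' f. f) \<rparr>"

end

theory Submission
  imports Defs "HOL-Library.Countable" "HOL-Library.Ramsey"
begin

text \<open>
  A boron tree becomes a rooted binary tree, with its hydrogen atoms as leaves, once an edge is
  subdivided by a root and the two subtrees at every inner vertex are put in an order (the tree with
  one vertex already is a rooted binary tree). Such planar trees carry what a G-category needs:
  their leaves are linearly ordered from left to right, and Kruskal's theorem makes them, with natural numbers attached to the leaves, well-quasi-ordered.
  The category \<open>\<D>\<close> therefore has planar binary trees as objects, and as morphisms the increasing
  maps between leaf sets that preserve and reflect \<open>\<rho>\<close>; the functor to boron trees forgets the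
  root and the planar order.

  The relation \<open>\<rho>\<close> passes between the two descriptions through splits. In a tree, two paths are
  disjoint exactly when some edge separates them (\<open>not_rho_iff_separating_edge\<close>), so \<open>\<rho>\<close> depends only
  on the partitions of the hydrogen atoms that arise by deleting an edge. In a rooted binary tree the
  corresponding data are the clusters, the leaf sets of its subtrees. Every boron tree is the
  unrooted form of a binary tree whose clusters are, up to complement, the sides of its edges
  (\<open>branch_btree\<close>, \<open>boron_tree_btree\<close>); this gives essential surjectivity. The objects of \<open>\<D>\<close> are
  those binary trees that describe some boron tree in this sense, and the functor picks one of these
  boron trees, which are all isomorphic, for each.

  For the wqo property, Kruskal's theorem (\<open>kruskal_btree\<close>, proved with a minimal bad sequence)
  supplies an embedding between two members of any sequence of weighted trees. Such an embedding
  induces an increasing map of leaves along which the clusters of the target restrict to exactly the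
  clusters of the source, up to the empty set (\<open>emb_imp_leaf_map\<close>). Since clusters determine \<open>\<rho>\<close>, this
  map is a morphism of \<open>\<D>\<close>.
\<close>


section \<open>Categories of finite sets with a quaternary structure\<close>

text \<open>
  Both the category of boron trees and the category of planar binary trees consist of finite sets
  with a function of four arguments that the morphisms preserve. A single function covers a quaternary
  relation together with a linear order, because its values may be pairs of truth values.
\<close>

definition str_hom ::
  "('o \<Rightarrow> 'x set) \<Rightarrow> ('o \<Rightarrow> 'x \<Rightarrow> 'x \<Rightarrow> 'x \<Rightarrow> 'x \<Rightarrow> 'b) \<Rightarrow> 'o \<Rightarrow> 'o \<Rightarrow> ('x \<Rightarrow> 'x) set" where
  "str_hom X val A B = {f \<in> X A \<rightarrow>\<^sub>E X B. inj_on f (X A) \<and>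
     (\<forall>w\<in>X A. \<forall>x\<in>X A. \<forall>y\<in>X A. \<forall>z\<in>X A. val A w x y z = val B (f w) (f x) (f y) (f z))}"

text \<open>
  The code \<open>enc A f\<close> stands for the map \<open>f\<close> with source \<open>A\<close>, and \<open>dec A\<close> recovers it. The coding
  makes it possible for the morphisms to be natural numbers.
\<close>

definition str_category ::
  "'o set \<Rightarrow> ('o \<Rightarrow> 'x set) \<Rightarrow> ('o \<Rightarrow> 'x \<Rightarrow> 'x \<Rightarrow> 'x \<Rightarrow> 'x \<Rightarrow> 'b) \<Rightarrow>
   ('o \<Rightarrow> ('x \<Rightarrow> 'x) \<Rightarrow> 'm) \<Rightarrow> ('o \<Rightarrow> 'm \<Rightarrow> 'x \<Rightarrow> 'x) \<Rightarrow> ('o, 'm) category" where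
  "str_category Obs X val enc dec =
     \<lparr> Ob = Obs,
       Hom = (\<lambda>A B. enc A ` str_hom X val A B),
       Ident = (\<lambda>A. enc A (\<lambda>x\<in>X A. x)),
       Comp = (\<lambda>A B C g f. enc A (compose (X A) (dec B g) (dec A f))) \<rparr>"

definition str_functor ::
  "('o \<Rightarrow> 'x set) \<Rightarrow> ('o \<Rightarrow> 'm \<Rightarrow> 'x \<Rightarrow> 'x) \<Rightarrow> ('o, 'm, 'x) to_FI" where
  "str_functor X dec = \<lparr> obj_map = X, mor_map = (\<lambda>A B. dec A) \<rparr>"

lemma str_hom_id: "(\<lambda>x\<in>X A. x) \<in> str_hom X val A A"
  by (auto simp: str_hom_def inj_on_def)

lemma str_hom_comp:
  assumes "f \<in> str_hom X val A B" "g \<in> str_hom X val B C"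
  shows "compose (X A) g f \<in> str_hom X val A C"
proof -
  have f: "f \<in> X A \<rightarrow> X B" "inj_on f (X A)" and g: "g \<in> X B \<rightarrow> X C" "inj_on g (X B)"
    using assms by (auto simp: str_hom_def)
  have "inj_on (compose (X A) g f) (X A)"
    using f g by (simp add: inj_on_def compose_def Pi_iff)
  moreover have "compose (X A) g f \<in> X A \<rightarrow>\<^sub>E X C"
    using f g by (auto simp: compose_def)
  moreover have "val A w x y z = val C (compose (X A) g f w) (compose (X A) g f x)
      (compose (X A) g f y) (compose (X A) g f z)"
    if "w \<in> X A" "x \<in> X A" "y \<in> X A" "z \<in> X A" for w x y z
    using assms that f(1) by (simp add: str_hom_def compose_def Pi_iff)
  ultimately show ?thesis by (simp add: str_hom_def)
qed

lemma str_hom_inverse: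
  assumes f: "f \<in> str_hom X val A B" and g: "g \<in> X B \<rightarrow>\<^sub>E X A"
    and fg: "compose (X B) f g = (\<lambda>x\<in>X B. x)"
  shows "g \<in> str_hom X val B A"
proof -
  have inv: "f (g x) = x" if "x \<in> X B" for x
    using fun_cong[OF fg, of x] that by (simp add: compose_def)
  have "inj_on g (X B)" by (rule inj_on_inverseI[of _ f]) (rule inv)
  moreover have "val B w x y z = val A (g w) (g x) (g y) (g z)"
    if "w \<in> X B" "x \<in> X B" "y \<in> X B" "z \<in> X B" for w x y z
  proof -
    have "g w \<in> X A" "g x \<in> X A" "g y \<in> X A" "g z \<in> X A" using g that by auto
    then have "val A (g w) (g x) (g y) (g z) = val B (f (g w)) (f (g x)) (f (g y)) (f (g z))"
      using f by (simp add: str_hom_def)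
    then show ?thesis using inv that by simp
  qed
  ultimately show ?thesis using g by (simp add: str_hom_def)
qed

lemma str_hom_ext: "f \<in> str_hom X val A B \<Longrightarrow> f \<in> extensional (X A)"
  by (auto simp: str_hom_def PiE_def)

text \<open>
  The underlying-set functor is conservative because the morphisms reflect the structure as well as
  preserve it, so that the inverse map of a bijective morphism is a morphism.
\<close>

lemma FI_concrete_str_category:
  assumes fin: "\<And>A. A \<in> Obs \<Longrightarrow> finite (X A)"
    and dec: "\<And>A f. A \<in> Obs \<Longrightarrow> f \<in> extensional (X A) \<Longrightarrow> dec A (enc A f) = f"
  shows "FI_concrete (str_category Obs X val enc dec) (str_functor X dec)"
proof -
  let ?C = "str_category Obs X val enc dec" and ?U = "str_functor X dec"
  have dec_hom: "dec A (enc A f) = f" if "A \<in> Obs" "f \<in> str_hom X val A B" for A B f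
    using dec that str_hom_ext by metis
  have dec_comp: "dec A (enc A (compose (X A) g f)) = compose (X A) g f" if "A \<in> Obs" for A g f
    using dec that compose_extensional by metis
  have dec_id: "dec A (enc A (\<lambda>x\<in>X A. x)) = (\<lambda>x\<in>X A. x)" if "A \<in> Obs" for A
    using dec that by simp
  have id_comp: "compose (X A) f (\<lambda>x\<in>X A. x) = f" "compose (X A) (\<lambda>x\<in>X B. x) f = f"
    if "f \<in> str_hom X val A B" for A B f
    using that by (auto simp: str_hom_def fun_eq_iff compose_def PiE_def extensional_def Pi_iff)
  have assoc: "compose (X A) h (compose (X A) g f) = compose (X A) (compose (X B) h g) f"
    if "f \<in> str_hom X val A B" for A B f g h
    using that by (auto simp: str_hom_def fun_eq_iff compose_def PiE_def Pi_iff)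
  have "is_category ?C"
    unfolding is_category_def str_category_def category.simps ball_simps
  proof (intro conjI ballI imageI)
    fix A B C f g
    assume "A \<in> Obs" "B \<in> Obs" "C \<in> Obs" "f \<in> str_hom X val A B" "g \<in> str_hom X val B C"
    then show "compose (X A) (dec B (enc B g)) (dec A (enc A f)) \<in> str_hom X val A C"
      by (simp add: dec_hom str_hom_comp)
  next
    fix A B C D f g h
    assume ob: "A \<in> Obs" "B \<in> Obs" "C \<in> Obs" "D \<in> Obs"
      and f: "f \<in> str_hom X val A B" and g: "g \<in> str_hom X val B C"
      and h: "h \<in> str_hom X val C D"
    show "enc A (compose (X A) (dec C (enc C h))
           (dec A (enc A (compose (X A) (dec B (enc B g)) (dec A (enc A f)))))) =
         enc A (compose (X A)
           (dec B (enc B (compose (X B) (dec C (enc C h)) (dec B (enc B g))))) (dec A (enc A f)))"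
      using ob f g h by (simp add: dec_hom dec_comp assoc[OF f])
  qed (simp_all add: str_hom_id[unfolded restrict_def] str_hom_id dec_hom dec_id id_comp)
  moreover have "is_functor ?C FI ?U"
    unfolding is_functor_def
    by (auto simp: str_category_def str_functor_def FI_def dec_hom dec_comp dec_id fin)
      (auto simp: str_hom_def)
  moreover have "faithful ?C ?U"
    unfolding faithful_def
    by (auto simp: str_category_def str_functor_def inj_on_def dec_hom)
  moreover have "conservative ?C FI ?U"
    unfolding conservative_def
  proof (intro ballI impI)
    fix A B m
    assume A: "A \<in> Ob ?C" and B: "B \<in> Ob ?C" and m: "m \<in> Hom ?C A B"
      and iso: "is_iso FI (obj_map ?U A) (obj_map ?U B) (mor_map ?U A B m)"
    from m obtain f where f: "f \<in> str_hom X val A B" and mf: "m = enc A f"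
      by (auto simp: str_category_def)
    have AB: "A \<in> Obs" "B \<in> Obs" using A B by (auto simp: str_category_def)
    from iso obtain g where g: "g \<in> X B \<rightarrow>\<^sub>E X A"
      and gf: "compose (X A) g f = (\<lambda>x\<in>X A. x)" and fg: "compose (X B) f g = (\<lambda>x\<in>X B. x)"
      using dec_hom[OF AB(1) f] by (auto simp: is_iso_def FI_def str_functor_def mf)
    have gh: "g \<in> str_hom X val B A" by (rule str_hom_inverse[OF f g fg])
    have dec_fg: "dec A m = f" "dec B (enc B g) = g"
      using dec_hom AB f gh by (simp_all add: mf)
    have "enc B g \<in> Hom ?C B A" using gh by (simp add: str_category_def)
    moreover have "Comp ?C A B A (enc B g) m = Ident ?C A"
      using gf by (simp add: str_category_def dec_fg)
    moreover have "Comp ?C B A B m (enc B g) = Ident ?C B"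
      using fg by (simp add: str_category_def dec_fg)
    ultimately show "is_iso ?C A B m"
      using m unfolding is_iso_def by blast
  qed
  ultimately show ?thesis by (simp add: FI_concrete_def)
qed

lemma boron_category_eq:
  "boron_category = str_category {T. boron_tree T} hydrogens rho (\<lambda>_ f. f) (\<lambda>_ f. f)"
  by (auto simp: boron_category_def str_category_def str_hom_def)

lemma hydrogen_functor_eq: "hydrogen_functor = str_functor hydrogens (\<lambda>_ f. f)"
  by (simp add: hydrogen_functor_def str_functor_def)

lemma FI_concrete_boron: "FI_concrete boron_category hydrogen_functor"
  unfolding boron_category_eq hydrogen_functor_eq
proof (rule FI_concrete_str_category)
  fix T :: "'a sgraph"
  assume "T \<in> {T. boron_tree T}"
  then have "finite (verts T)" by (simp add: boron_tree_def finite_tree_def)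
  then show "finite (hydrogens T)" by (simp add: hydrogens_def)
qed simp

text \<open>
  Representatives of isomorphism classes may be exchanged along isomorphisms, so the wqo property
  is a matter of finding one morphism in every sequence of weighted objects.
\<close>

lemma weighted_classes_wqo:
  assumes E: "FI_concrete \<E> U"
    and good: "\<And>s :: nat \<Rightarrow> _. range s \<subseteq> Ob (weighted \<E> U) \<Longrightarrow>
      \<exists>i j. i < j \<and> Hom (weighted \<E> U) (s i) (s j) \<noteq> {}"
  shows "wqo_on (weighted_le \<E> U) (weighted_classes \<E> U)"
proof -
  let ?W = "weighted \<E> U"
  define le where "le a b \<longleftrightarrow> Hom ?W a b \<noteq> {}" for a b
  have cat: "is_category \<E>" and func: "is_functor \<E> FI U"
    using E by (auto simp: FI_concrete_def)
  have id: "mor_map U A A (Ident \<E> A) = (\<lambda>x\<in>obj_map U A. x)" if "A \<in> Ob \<E>" for A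
    using func that by (simp add: is_functor_def FI_def)
  have refl: "le a a" if aW: "a \<in> Ob ?W" for a
  proof -
    obtain A \<alpha> where a: "a = (A, \<alpha>)" "A \<in> Ob \<E>" using aW by (cases a) (auto simp: weighted_def)
    then have "Ident \<E> A \<in> Hom ?W a a"
      using cat id[OF a(2)] by (simp add: weighted_def is_category_def)
    then show ?thesis unfolding le_def by blast
  qed
  have trans: "le a c" if abc: "a \<in> Ob ?W" "b \<in> Ob ?W" "c \<in> Ob ?W" "le a b" "le b c" for a b c
  proof -
    obtain A \<alpha> B \<beta> C \<gamma> where [simp]: "a = (A, \<alpha>)" "b = (B, \<beta>)" "c = (C, \<gamma>)"
      by (cases a, cases b, cases c)
    have ob: "A \<in> Ob \<E>" "B \<in> Ob \<E>" "C \<in> Ob \<E>" using abc by (auto simp: weighted_def)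
    obtain f g where f: "f \<in> Hom \<E> A B" "\<And>x. x \<in> obj_map U A \<Longrightarrow> \<alpha> x \<le> \<beta> (mor_map U A B f x)"
      and g: "g \<in> Hom \<E> B C" "\<And>x. x \<in> obj_map U B \<Longrightarrow> \<beta> x \<le> \<gamma> (mor_map U B C g x)"
      using abc(4,5) by (auto simp: weighted_def le_def)
    have gf: "Comp \<E> A B C g f \<in> Hom \<E> A C"
      using cat ob f g by (simp add: is_category_def)
    have mgf: "mor_map U A C (Comp \<E> A B C g f) =
        compose (obj_map U A) (mor_map U B C g) (mor_map U A B f)"
      using func ob f g by (simp add: is_functor_def FI_def)
    have "mor_map U A B f \<in> Hom FI (obj_map U A) (obj_map U B)"
      using func ob f by (simp add: is_functor_def)
    then have mf: "mor_map U A B f x \<in> obj_map U B" if "x \<in> obj_map U A" for x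
      using that by (auto simp: FI_def)
    have "Comp \<E> A B C g f \<in> Hom ?W a c"
    proof -
      have "\<alpha> x \<le> \<gamma> (mor_map U A C (Comp \<E> A B C g f) x)" if "x \<in> obj_map U A" for x
        using le_trans[OF f(2)[OF that] g(2)[OF mf[OF that]]] that by (simp add: mgf compose_def)
      then show ?thesis using gf by (simp add: weighted_def)
    qed
    then show ?thesis unfolding le_def by blast
  qed
  have cls: "\<exists>a\<in>X. X \<subseteq> Ob ?W \<and> (\<forall>b\<in>X. le a b \<and> le b a)"
    if X: "X \<in> weighted_classes \<E> U" for X
  proof -
    obtain a where a: "a \<in> Ob ?W" "X = {(a, b). a \<in> Ob ?W \<and> b \<in> Ob ?W \<and> isomorphic ?W a b} `` {a}"
      using X by (auto simp: weighted_classes_def Let_def elim!: quotientE)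
    have "is_iso ?W a a (Ident ?W a)"
    proof -
      obtain A \<alpha> where aA: "a = (A, \<alpha>)" "A \<in> Ob \<E>" using a(1) by (cases a) (auto simp: weighted_def)
      have "Ident \<E> A \<in> Hom \<E> A A" "Comp \<E> A A A (Ident \<E> A) (Ident \<E> A) = Ident \<E> A"
        using cat aA(2) unfolding is_category_def by blast+
      then have "Ident \<E> A \<in> Hom ?W a a" "Comp ?W a a a (Ident \<E> A) (Ident \<E> A) = Ident ?W a"
        "Ident ?W a = Ident \<E> A"
        using id[OF aA(2)] by (simp_all add: aA(1) weighted_def)
      then show ?thesis unfolding is_iso_def by auto
    qed
    then have "a \<in> X" using a by (auto simp: isomorphic_def)
    moreover have "le a b \<and> le b a" if "b \<in> X" for b
      using that a by (auto simp: isomorphic_def is_iso_def le_def)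
    moreover have "X \<subseteq> Ob ?W" using a by auto
    ultimately show ?thesis by blast
  qed
  have wle: "weighted_le \<E> U X Y \<longleftrightarrow> (\<exists>a\<in>X. \<exists>b\<in>Y. le a b)" for X Y
    by (simp add: weighted_le_def le_def)
  show ?thesis
    unfolding wqo_on_def
  proof (intro conjI allI impI)
    show "reflp_on (weighted_classes \<E> U) (weighted_le \<E> U)"
      using cls unfolding reflp_on_def wle by blast
    show "transp_on (weighted_classes \<E> U) (weighted_le \<E> U)"
    proof (rule transp_onI)
      fix X Y Z
      assume XYZ: "X \<in> weighted_classes \<E> U" "Y \<in> weighted_classes \<E> U" "Z \<in> weighted_classes \<E> U"
        and "weighted_le \<E> U X Y" "weighted_le \<E> U Y Z"
      then obtain a b b' c where *: "a \<in> X" "b \<in> Y" "le a b" "b' \<in> Y" "c \<in> Z" "le b' c"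
        by (auto simp: wle)
      moreover obtain y where y: "y \<in> Y" "le b y" "le y b'" using cls[OF XYZ(2)] * by blast
      moreover have "X \<subseteq> Ob ?W" "Y \<subseteq> Ob ?W" "Z \<subseteq> Ob ?W" using cls XYZ by blast+
      ultimately have "le a b'" "le b' c" "a \<in> Ob ?W" "b' \<in> Ob ?W" "c \<in> Ob ?W"
        using trans[of a b y] trans[of a y b'] by blast+
      then have "le a c" using trans by blast
      then show "weighted_le \<E> U X Z" using * by (auto simp: wle)
    qed
    fix s :: "nat \<Rightarrow> ('a \<times> ('c \<Rightarrow> nat)) set" assume s: "range s \<subseteq> weighted_classes \<E> U"
    then have "\<forall>i. \<exists>a. a \<in> s i \<and> a \<in> Ob ?W" using cls by blast
    then obtain a where a: "\<And>i. a i \<in> s i" "\<And>i. a i \<in> Ob ?W" by metis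
    then have "range a \<subseteq> Ob ?W" by blast
    then obtain i j where "i < j" "le (a i) (a j)" using good[of a] unfolding le_def by blast
    then show "\<exists>i j. i < j \<and> weighted_le \<E> U (s i) (s j)" unfolding wle using a(1) by blast
  qed
qed


section \<open>Binary trees and their clusters\<close>

datatype 'a btree = Leaf 'a | Node "'a btree" "'a btree"

instance btree :: (countable) countable
  by countable_datatype

fun leaves :: "'a btree \<Rightarrow> 'a list" where
  "leaves (Leaf a) = [a]"
| "leaves (Node l r) = leaves l @ leaves r"

fun clusters :: "'a btree \<Rightarrow> 'a set set" where
  "clusters (Leaf a) = {{a}}"
| "clusters (Node l r) = insert (set_btree l \<union> set_btree r) (clusters l \<union> clusters r)"

text \<open>
  A set is considered together with its complement, since an edge of an unrooted tree has no
  preferred side.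
\<close>

definition separates :: "'a set \<Rightarrow> 'a \<Rightarrow> 'a \<Rightarrow> 'a \<Rightarrow> 'a \<Rightarrow> bool" where
  "separates C w x y z \<longleftrightarrow> (w \<in> C \<and> x \<in> C \<and> y \<notin> C \<and> z \<notin> C) \<or> (w \<notin> C \<and> x \<notin> C \<and> y \<in> C \<and> z \<in> C)"

text \<open>
  This is the relation \<open>\<rho>\<close> of the unrooted tree that underlies \<open>t\<close>. The cluster of all leaves separates
  nothing, and the two clusters below the root are complementary, so they describe the same edge.
\<close>

definition leaf_rho :: "'a btree \<Rightarrow> 'a \<Rightarrow> 'a \<Rightarrow> 'a \<Rightarrow> 'a \<Rightarrow> bool" where
  "leaf_rho t w x y z \<longleftrightarrow> (\<forall>C\<in>clusters t. \<not> separates C w x y z)"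

lemma set_leaves [simp]: "set (leaves t) = set_btree t"
  by (induction t) auto

lemma leaves_map: "leaves (map_btree f t) = map f (leaves t)"
  by (induction t) auto

lemma finite_set_btree [simp]: "finite (set_btree t)"
  by (metis List.finite_set set_leaves)

lemma set_btree_in_clusters: "set_btree t \<in> clusters t"
  by (cases t) auto

lemma clusters_subset: "C \<in> clusters t \<Longrightarrow> C \<subseteq> set_btree t"
  by (induction t) auto

lemma clusters_map: "clusters (map_btree f t) = (`) f ` clusters t"
  by (induction t) (auto simp: btree.set_map image_Un)

lemma leaf_rho_map:
  assumes "inj_on f (set_btree t)" "w \<in> set_btree t" "x \<in> set_btree t" "y \<in> set_btree t" "z \<in> set_btree t"
  shows "leaf_rho (map_btree f t) (f w) (f x) (f y) (f z) \<longleftrightarrow> leaf_rho t w x y z"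
proof -
  have "f u \<in> f ` C \<longleftrightarrow> u \<in> C" if "C \<in> clusters t" "u \<in> set_btree t" for C u
    using inj_on_image_mem_iff[OF assms(1)] clusters_subset that by metis
  then show ?thesis using assms by (simp add: leaf_rho_def clusters_map separates_def)
qed

text \<open>
  Kruskal's embedding for binary trees in which only the leaves are labelled: \<open>P\<close> compares the labels
  of matched leaves, and a subtree of the target may be skipped.
\<close>

fun emb :: "('a \<Rightarrow> 'b \<Rightarrow> bool) \<Rightarrow> 'a btree \<Rightarrow> 'b btree \<Rightarrow> bool" where
  "emb P (Leaf a) (Leaf b) \<longleftrightarrow> P a b"
| "emb P (Node a b) (Leaf _) \<longleftrightarrow> False"
| "emb P (Leaf a) (Node c d) \<longleftrightarrow> emb P (Leaf a) c \<or> emb P (Leaf a) d"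
| "emb P (Node a b) (Node c d) \<longleftrightarrow>
     emb P (Node a b) c \<or> emb P (Node a b) d \<or> (emb P a c \<and> emb P b d)"

lemma emb_map:
  "emb P (map_btree f s) (map_btree g t) \<longleftrightarrow> emb (\<lambda>x y. P (f x) (g y)) s t"
  by (induction "\<lambda>x y. P (f x) (g y)" s t rule: emb.induct) auto

text \<open>
  The last condition makes \<open>f\<close> preserve and reflect \<open>leaf_rho\<close>. The empty set is added on both sides
  because a cluster of the target may miss the image of \<open>f\<close>, and because the empty set separates nothing.
\<close>

definition leaf_map :: "('a \<Rightarrow> 'b \<Rightarrow> bool) \<Rightarrow> 'a::order btree \<Rightarrow> 'b::order btree \<Rightarrow> ('a \<Rightarrow> 'b) \<Rightarrow> bool" where
  "leaf_map P s t f \<longleftrightarrow>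
     (\<forall>x\<in>set_btree s. f x \<in> set_btree t \<and> P x (f x)) \<and> strict_mono_on (set_btree s) f \<and>
     insert {} ((\<lambda>C. f -` C \<inter> set_btree s) ` clusters t) = insert {} (clusters s)"

lemma insert_insert_Un: "insert e (insert W (A \<union> B)) = insert W (insert e A \<union> insert e B)"
  by blast

lemma leaf_mapI:
  assumes "\<And>x. x \<in> set_btree s \<Longrightarrow> f x \<in> set_btree t" "\<And>x. x \<in> set_btree s \<Longrightarrow> P x (f x)"
    "strict_mono_on (set_btree s) f"
    "insert {} ((\<lambda>C. f -` C \<inter> set_btree s) ` clusters t) = insert {} (clusters s)"
  shows "leaf_map P s t f"
  unfolding leaf_map_def by (intro conjI ballI assms)

lemma leaf_mapD:
  assumes "leaf_map P s t f"
  shows "x \<in> set_btree s \<Longrightarrow> f x \<in> set_btree t" "x \<in> set_btree s \<Longrightarrow> P x (f x)"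
    "strict_mono_on (set_btree s) f"
    "insert {} ((\<lambda>C. f -` C \<inter> set_btree s) ` clusters t) = insert {} (clusters s)"
proof -
  note * = assms[unfolded leaf_map_def]
  show "x \<in> set_btree s \<Longrightarrow> f x \<in> set_btree t" "x \<in> set_btree s \<Longrightarrow> P x (f x)"
    using conjunct1[OF *] by blast+
  show "strict_mono_on (set_btree s) f" by (rule conjunct1[OF conjunct2[OF *]])
  show "insert {} ((\<lambda>C. f -` C \<inter> set_btree s) ` clusters t) = insert {} (clusters s)"
    by (rule conjunct2[OF conjunct2[OF *]])
qed

text \<open>
  When a sibling subtree \<open>d\<close> is skipped, its clusters restrict to the empty set, and the new cluster
  of all leaves restricts to the full leaf set of \<open>s\<close>, which is already a cluster of \<open>s\<close>.
\<close>

lemma leaf_map_skip_sibling: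
  assumes "leaf_map P s c f" "set_btree c \<inter> set_btree d = {}"
  shows "leaf_map P s (Node c d) f" "leaf_map P s (Node d c) f"
proof -
  have f: "f x \<in> set_btree c" if "x \<in> set_btree s" for x
    using leaf_mapD(1)[OF assms(1) that] .
  then have 1: "f -` (set_btree c \<union> set_btree d) \<inter> set_btree s = set_btree s"
    "f -` (set_btree d \<union> set_btree c) \<inter> set_btree s = set_btree s" by auto
  have 2: "f -` C \<inter> set_btree s = {}" if "C \<in> clusters d" for C
    using f assms(2) clusters_subset[OF that] by auto
  have 3: "insert {} ((\<lambda>C. f -` C \<inter> set_btree s) ` clusters d) = {{}}"
    using 2 by auto
  have 4: "insert {} ((\<lambda>C. f -` C \<inter> set_btree s) ` clusters c) = insert {} (clusters s)"
    by (rule leaf_mapD(4)[OF assms(1)])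
  have "insert {} ((\<lambda>C. f -` C \<inter> set_btree s) ` clusters (Node c d)) =
      insert (set_btree s) (insert {} (clusters s) \<union> {{}})"
    unfolding clusters.simps image_insert image_Un 1 insert_insert_Un 3 4 ..
  moreover have "insert {} ((\<lambda>C. f -` C \<inter> set_btree s) ` clusters (Node d c)) =
      insert (set_btree s) ({{}} \<union> insert {} (clusters s))"
    unfolding clusters.simps image_insert image_Un 1 insert_insert_Un 3 4 ..
  moreover have "insert (set_btree s) (insert {} (clusters s) \<union> {{}}) = insert {} (clusters s)"
    "insert (set_btree s) ({{}} \<union> insert {} (clusters s)) = insert {} (clusters s)"
    using set_btree_in_clusters[of s] by (simp_all add: insert_absorb insert_commute)
  ultimately have "insert {} ((\<lambda>C. f -` C \<inter> set_btree s) ` clusters (Node c d)) = insert {} (clusters s)"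
    "insert {} ((\<lambda>C. f -` C \<inter> set_btree s) ` clusters (Node d c)) = insert {} (clusters s)"
    by simp_all
  then show "leaf_map P s (Node c d) f" "leaf_map P s (Node d c) f"
    using f leaf_mapD(2,3)[OF assms(1)]
    by (intro leaf_mapI; simp del: clusters.simps)+
qed

text \<open>
  Every cluster of the target other than the full leaf set lies in one of the two halves, so it
  restricts to the leaves of the corresponding half of the source.
\<close>

lemma leaf_map_Node:
  assumes f: "leaf_map P a c f" and g: "leaf_map P b d g"
    and s: "sorted_wrt (<) (leaves (Node a b))" and t: "sorted_wrt (<) (leaves (Node c d))"
  shows "leaf_map P (Node a b) (Node c d) (\<lambda>x. if x \<in> set_btree a then f x else g x)"
proof -
  let ?h = "\<lambda>x. if x \<in> set_btree a then f x else g x"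
  let ?A = "set_btree a" and ?B = "set_btree b" and ?C = "set_btree c" and ?D = "set_btree d"
  have ab: "x < y" if "x \<in> ?A" "y \<in> ?B" for x y using s that by (auto simp: sorted_wrt_append)
  have cd: "x < y" if "x \<in> ?C" "y \<in> ?D" for x y using t that by (auto simp: sorted_wrt_append)
  have disj: "?A \<inter> ?B = {}" "?C \<inter> ?D = {}" using ab cd by fastforce+
  have fa: "f x \<in> ?C" "P x (f x)" if "x \<in> ?A" for x using leaf_mapD[OF f] that by blast+
  have gb: "g x \<in> ?D" "P x (g x)" if "x \<in> ?B" for x using leaf_mapD[OF g] that by blast+
  have "strict_mono_on (?A \<union> ?B) ?h"
  proof (rule strict_mono_onI)
    fix x y assume xy: "x \<in> ?A \<union> ?B" "y \<in> ?A \<union> ?B" "x < y"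
    have "strict_mono_on ?A f" "strict_mono_on ?B g" by (rule leaf_mapD[OF f] leaf_mapD[OF g])+
    moreover have "\<not> (x \<in> ?B \<and> y \<in> ?A)" using ab xy(3) by (meson less_asym)
    ultimately show "?h x < ?h y" using xy disj fa gb cd
      by (auto dest: strict_mono_onD)
  qed
  moreover have "?h x \<in> ?C \<union> ?D \<and> P x (?h x)" if "x \<in> ?A \<union> ?B" for x
    using that fa gb by auto
  moreover have "insert {} ((\<lambda>C. ?h -` C \<inter> (?A \<union> ?B)) ` clusters (Node c d)) =
      insert {} (clusters (Node a b))"
  proof -
    have 1: "?h -` (?C \<union> ?D) \<inter> (?A \<union> ?B) = ?A \<union> ?B" using fa gb by auto
    have 2: "?h -` C \<inter> (?A \<union> ?B) = f -` C \<inter> ?A" if "C \<in> clusters c" for C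
      using clusters_subset[OF that] gb disj by (auto split: if_splits)
    have 3: "?h -` C \<inter> (?A \<union> ?B) = g -` C \<inter> ?B" if "C \<in> clusters d" for C
    proof -
      have "f x \<notin> C" if "x \<in> ?A" for x
        using clusters_subset[OF \<open>C \<in> clusters d\<close>] fa(1)[OF that] disj(2) by blast
      then show ?thesis using disj(1) by (auto split: if_splits)
    qed
    have "insert {} ((\<lambda>C. ?h -` C \<inter> (?A \<union> ?B)) ` clusters (Node c d)) =
       insert (?A \<union> ?B) (insert {} ((\<lambda>C. f -` C \<inter> ?A) ` clusters c) \<union>
         insert {} ((\<lambda>C. g -` C \<inter> ?B) ` clusters d))"
      unfolding clusters.simps image_insert image_Un 1 insert_insert_Un
      by (simp only: 2 3 cong: image_cong)
    also have "\<dots> = insert (?A \<union> ?B) (insert {} (clusters a) \<union> insert {} (clusters b))"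
      unfolding leaf_mapD(4)[OF f] leaf_mapD(4)[OF g] ..
    finally show ?thesis by auto
  qed
  ultimately show ?thesis by (intro leaf_mapI) simp_all
qed

lemma sorted_leaves_NodeD:
  assumes "sorted_wrt (<) (leaves (Node c d :: 'a::order btree))"
  shows "sorted_wrt (<) (leaves c)" "sorted_wrt (<) (leaves d)"
    "set_btree c \<inter> set_btree d = {}" "set_btree d \<inter> set_btree c = {}"
proof -
  have *: "x < y" if "x \<in> set_btree c" "y \<in> set_btree d" for x y
    using assms that by (simp add: sorted_wrt_append)
  show "set_btree c \<inter> set_btree d = {}" "set_btree d \<inter> set_btree c = {}"
    using * less_irrefl by blast+
qed (use assms in \<open>simp_all add: sorted_wrt_append\<close>)

text \<open>
  Because labels increase from left to right, sibling subtrees have disjoint leaf sets, and maps on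
  the two halves combine to an increasing map.
\<close>

lemma emb_imp_leaf_map:
  assumes "emb P s t" "sorted_wrt (<) (leaves s)" "sorted_wrt (<) (leaves t)"
  shows "\<exists>f. leaf_map P s t f"
  using assms
proof (induction P s t rule: emb.induct)
  case (1 P a b)
  then have "leaf_map P (Leaf a) (Leaf b) (\<lambda>_. b)"
    by (auto simp: leaf_map_def strict_mono_on_def)
  then show ?case by blast
next
  case (3 P a c d)
  note cd = sorted_leaves_NodeD[OF 3(5)]
  consider "emb P (Leaf a) c" | "emb P (Leaf a) d"
    using 3(3) by auto
  then show ?case
  proof cases
    case 1
    then obtain f where "leaf_map P (Leaf a) c f" using 3(1)[OF _ 3(4) cd(1)] by blast
    then show ?thesis using leaf_map_skip_sibling(1)[OF _ cd(3)] by blast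
  next
    case 2
    then obtain f where "leaf_map P (Leaf a) d f" using 3(2)[OF _ 3(4) cd(2)] by blast
    then show ?thesis using leaf_map_skip_sibling(2)[OF _ cd(4)] by blast
  qed
next
  case (4 P a b c d)
  note ab = sorted_leaves_NodeD[OF 4(6)] and cd = sorted_leaves_NodeD[OF 4(7)]
  consider "emb P (Node a b) c" | "emb P (Node a b) d" | "emb P a c" "emb P b d"
    using 4(5) by auto
  then show ?case
  proof cases
    case 1
    then obtain f where "leaf_map P (Node a b) c f" using 4(1)[OF _ 4(6) cd(1)] by blast
    then show ?thesis using leaf_map_skip_sibling(1)[OF _ cd(3)] by blast
  next
    case 2
    then obtain f where "leaf_map P (Node a b) d f" using 4(2)[OF _ 4(6) cd(2)] by blast
    then show ?thesis using leaf_map_skip_sibling(2)[OF _ cd(4)] by blast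
  next
    case 3
    obtain f where "leaf_map P a c f" using 4(3)[OF 3(1) ab(1) cd(1)] by blast
    moreover obtain g where "leaf_map P b d g" using 4(4)[OF 3(2) ab(2) cd(2)] by blast
    ultimately show ?thesis using leaf_map_Node[OF _ _ 4(6,7)] by blast
  qed
qed simp

lemma leaf_map_rho:
  assumes f: "leaf_map P s t f"
    and "w \<in> set_btree s" "x \<in> set_btree s" "y \<in> set_btree s" "z \<in> set_btree s"
  shows "leaf_rho s w x y z \<longleftrightarrow> leaf_rho t (f w) (f x) (f y) (f z)"
proof -
  let ?tr = "\<lambda>C. f -` C \<inter> set_btree s"
  have "leaf_rho s w x y z \<longleftrightarrow> (\<forall>C\<in>insert {} (clusters s). \<not> separates C w x y z)"
    by (auto simp: leaf_rho_def separates_def)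
  also have "\<dots> \<longleftrightarrow> (\<forall>C\<in>insert {} (?tr ` clusters t). \<not> separates C w x y z)"
    unfolding leaf_mapD(4)[OF f] ..
  also have "\<dots> \<longleftrightarrow> leaf_rho t (f w) (f x) (f y) (f z)"
    using assms(2-) by (auto simp: leaf_rho_def separates_def)
  finally show ?thesis .
qed


section \<open>Kruskal's theorem for binary trees\<close>

definition good_on :: "('a \<Rightarrow> 'a \<Rightarrow> bool) \<Rightarrow> 'a set \<Rightarrow> bool" where
  "good_on P S \<longleftrightarrow> (\<forall>s :: nat \<Rightarrow> 'a. range s \<subseteq> S \<longrightarrow> (\<exists>i j. i < j \<and> P (s i) (s j)))"

text \<open>
  Ramsey's theorem, applied to the colouring of pairs \<open>i < j\<close> by the truth of \<open>P (s i) (s j)\<close>: a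
  homogeneous set on which \<open>P\<close> always fails would be a bad sequence.
\<close>

lemma good_on_homogeneous:
  fixes s :: "nat \<Rightarrow> 'a"
  assumes good: "good_on P S" and "infinite Z" and s: "\<And>i. i \<in> Z \<Longrightarrow> s i \<in> S"
  shows "\<exists>Y. Y \<subseteq> Z \<and> infinite Y \<and> (\<forall>i\<in>Y. \<forall>j\<in>Y. i < j \<longrightarrow> P (s i) (s j))"
proof -
  define col where "col e = (if P (s (Min e)) (s (Max e)) then 0 else 1 :: nat)" for e
  have "\<forall>x\<in>Z. \<forall>y\<in>Z. x \<noteq> y \<longrightarrow> col {x, y} < 2" by (simp add: col_def)
  from Ramsey2[OF assms(2) this] obtain Y c where Y: "Y \<subseteq> Z" "infinite Y"
    and c: "\<forall>i\<in>Y. \<forall>j\<in>Y. i \<noteq> j \<longrightarrow> col {i, j} = c"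
    by (elim exE conjE)
  have "range (\<lambda>k. s (enumerate Y k)) \<subseteq> S"
    using Y s enumerate_in_set[OF Y(2)] by blast
  from good[unfolded good_on_def, rule_format, OF this]
  obtain i j where ij: "i < j" "P (s (enumerate Y i)) (s (enumerate Y j))" by blast
  let ?i = "enumerate Y i" and ?j = "enumerate Y j"
  have "?i < ?j" "?i \<in> Y" "?j \<in> Y" using ij Y by (simp_all add: enumerate_mono enumerate_in_set)
  then have "c = 0" using c[rule_format, of ?i ?j] ij by (simp add: col_def)
  then have "P (s i) (s j)" if "i \<in> Y" "j \<in> Y" "i < j" for i j
    using c[rule_format, of i j] that \<open>c = 0\<close> by (simp add: col_def split: if_splits)
  then show ?thesis using Y by blast
qed

lemma good_on_subsequence:
  fixes s :: "nat \<Rightarrow> 'a"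
  assumes "good_on P S" "infinite Z" "\<And>i. i \<in> Z \<Longrightarrow> s i \<in> S"
  shows "\<exists>i\<in>Z. \<exists>j\<in>Z. i < j \<and> P (s i) (s j)"
proof -
  obtain Y where Y: "Y \<subseteq> Z" "infinite Y" "\<forall>i\<in>Y. \<forall>j\<in>Y. i < j \<longrightarrow> P (s i) (s j)"
    using good_on_homogeneous[of P S Z s] assms by blast
  obtain i where "i \<in> Y" using Y(2) by (metis finite.emptyI ex_in_conv)
  moreover obtain j where "j \<in> Y" "i < j" using Y(2) by (meson infinite_nat_iff_unbounded)
  ultimately show ?thesis using Y by blast
qed

lemma good_on_le_nat: "good_on ((\<le>) :: nat \<Rightarrow> _) UNIV"
  unfolding good_on_def
proof (intro allI impI)
  fix s :: "nat \<Rightarrow> nat"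
  obtain i where "\<And>j. s i \<le> s j" using ex_has_least_nat[of "\<lambda>_. True" _ s] by auto
  then show "\<exists>i j. i < j \<and> s i \<le> s j" by blast
qed

text \<open>
  The terms of \<open>m\<close> are chosen one after another: the term at position \<open>n\<close> has least size among all
  bad sequences with the terms before \<open>n\<close> already fixed. The sequence \<open>M n\<close> in the proof is a bad
  sequence that is optimal at position \<open>n\<close> and agrees with \<open>M (n - 1)\<close> before it; \<open>m\<close> is the diagonal.
\<close>

lemma minimal_bad_sequence:
  fixes bad :: "(nat \<Rightarrow> 'a) \<Rightarrow> bool" and size' :: "'a \<Rightarrow> nat"
  assumes "bad s0" and bad: "\<And>s. bad s \<longleftrightarrow> (\<forall>i j. i < j \<longrightarrow> \<not> Q (s i) (s j))"
  shows "\<exists>m. bad m \<and> (\<forall>n s. bad s \<and> (\<forall>i<n. s i = m i) \<longrightarrow> size' (m n) \<le> size' (s n))"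
proof -
  define opt where
    "opt n s \<longleftrightarrow> bad s \<and> (\<forall>s'. bad s' \<and> (\<forall>i<n. s' i = s i) \<longrightarrow> size' (s n) \<le> size' (s' n))" for n s
  have ex: "\<exists>s'. opt n s' \<and> (\<forall>i<n. s' i = s i)" if s: "bad s" for n s
  proof -
    obtain s' where "bad s' \<and> (\<forall>i<n. s' i = s i)"
      "\<And>s''. bad s'' \<and> (\<forall>i<n. s'' i = s i) \<Longrightarrow> size' (s' n) \<le> size' (s'' n)"
      using ex_has_least_nat[of "\<lambda>s'. bad s' \<and> (\<forall>i<n. s' i = s i)" s "\<lambda>s'. size' (s' n)"] s
      by blast
    then show ?thesis unfolding opt_def by (intro exI[of _ s']) auto
  qed
  have "\<exists>M. \<forall>n. opt n (M n) \<and> (\<forall>i<Suc n. M (Suc n) i = M n i)"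
    by (rule dependent_nat_choice) (use ex assms(1) opt_def in blast)+
  then obtain M where M: "\<And>n. opt n (M n)" "\<And>n i. i \<le> n \<Longrightarrow> M (Suc n) i = M n i"
    by (auto simp: less_Suc_eq_le)
  have agree: "M n i = M i i" if "i \<le> n" for n i
    using that by (induction n rule: dec_induct) (auto simp: M(2))
  define m where "m i = M i i" for i
  have "\<not> Q (m i) (m j)" if "i < j" for i j
  proof -
    have "bad (M j)" using M(1) by (simp add: opt_def)
    then have "\<not> Q (M j i) (M j j)" using that bad by blast
    then show ?thesis using that agree[of i j] by (simp add: m_def)
  qed
  then have "bad m" by (simp add: bad)
  moreover have "size' (m n) \<le> size' (s n)" if "bad s" "\<forall>i<n. s i = m i" for n s
  proof -
    have "\<forall>i<n. s i = M n i" using that(2) agree[of _ n] by (simp add: m_def)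
    then show ?thesis using M(1)[of n] that(1) unfolding opt_def m_def by blast
  qed
  ultimately show ?thesis by blast
qed

lemma emb_Node_right: "emb P s c \<Longrightarrow> emb P s (Node c d)" "emb P s d \<Longrightarrow> emb P s (Node c d)"
  by (cases s; simp)+

text \<open>
  The argument of Nash-Williams. The immediate subtrees of the terms of a minimal bad sequence \<open>m\<close> are
  well-quasi-ordered, as a bad sequence of such subtrees could replace a tail of \<open>m\<close> and contradict
  its minimality. By Ramsey's theorem two terms of \<open>m\<close> then have comparable left subtrees and
  comparable right subtrees, unless infinitely many terms are leaves, which are comparable by
  hypothesis.
\<close>

theorem kruskal_btree:
  assumes "good_on P UNIV"
  shows "good_on (emb P) UNIV"
proof (rule ccontr)
  define bad where "bad s \<longleftrightarrow> (\<forall>i j. i < j \<longrightarrow> \<not> emb P (s i) (s j))" for s :: "nat \<Rightarrow> 'a btree"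
  assume "\<not> ?thesis"
  then obtain s0 where "bad s0" by (auto simp: good_on_def bad_def)
  then obtain m where m: "bad m"
    and min: "\<And>n s. bad s \<Longrightarrow> (\<And>i. i < n \<Longrightarrow> s i = m i) \<Longrightarrow> size (m n) \<le> size (s n)"
    using minimal_bad_sequence[of bad s0 "emb P" size] bad_def by blast
  define child where "child i t \<longleftrightarrow> (\<exists>l r. m i = Node l r \<and> (t = l \<or> t = r))" for i t
  define S where "S = {t. \<exists>i. child i t}"
  have child_emb: "emb P u (m i)" if "child i t" "emb P u t" for i t u
    using that emb_Node_right by (auto simp: child_def)
  have child_size: "size t < size (m i)" if "child i t" for i t
    using that by (auto simp: child_def)
  have "good_on (emb P) S"
    unfolding good_on_def
  proof (intro allI impI, rule ccontr)
    fix s :: "nat \<Rightarrow> 'a btree"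
    assume "range s \<subseteq> S" and s: "\<not> (\<exists>i j. i < j \<and> emb P (s i) (s j))"
    then have "\<forall>k. \<exists>i. child i (s k)" by (auto simp: S_def)
    then obtain p where p: "\<And>k. child (p k) (s k)" by metis
    obtain k where k: "\<And>l. p k \<le> p l" using ex_has_least_nat[of "\<lambda>_. True" _ p] by auto
    \<comment> \<open>The bad sequence \<open>s\<close> is started at an index \<open>k\<close> where its parent index \<open>p k\<close> is least, so that every later parent has index at least \<open>p k\<close>.\<close>
    define s' where "s' i = (if i < p k then m i else s (k + (i - p k)))" for i
    have "bad s'"
      unfolding bad_def
    proof (intro allI impI)
      fix i j :: nat assume ij: "i < j"
      consider "j < p k" | "i < p k" "p k \<le> j" | "p k \<le> i" by linarith
      then show "\<not> emb P (s' i) (s' j)"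
      proof cases
        case 1
        then show ?thesis using m ij by (simp add: s'_def bad_def)
      next
        case 2
        let ?l = "k + (j - p k)"
        have "i < p ?l" using 2 k[of ?l] by simp
        then have "\<not> emb P (m i) (m (p ?l))" using m by (simp add: bad_def)
        then show ?thesis using 2 child_emb[OF p] by (auto simp: s'_def)
      next
        case 3
        then have "k + (i - p k) < k + (j - p k)" using ij by simp
        then have "\<not> emb P (s (k + (i - p k))) (s (k + (j - p k)))" using s by blast
        then show ?thesis using 3 ij by (simp add: s'_def)
      qed
    qed
    then have "size (m (p k)) \<le> size (s' (p k))" by (rule min) (simp add: s'_def)
    then show False using child_size[OF p[of k]] by (simp add: s'_def)
  qed
  note S = this
  let ?L = "{i. \<exists>a. m i = Leaf a}" and ?N = "{i. \<exists>l r. m i = Node l r}"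
  have "?L \<union> ?N = UNIV" by (auto, metis btree.exhaust)
  then consider "infinite ?L" | "infinite ?N" by (metis finite_UnI infinite_UNIV_nat)
  then have "\<exists>i j. i < j \<and> emb P (m i) (m j)"
  proof cases
    case 1
    define a where "a i = (SOME a. m i = Leaf a)" for i
    have a: "m i = Leaf (a i)" if "i \<in> ?L" for i using that by (auto simp: a_def)
    obtain i j where "i \<in> ?L" "j \<in> ?L" "i < j" "P (a i) (a j)"
      using good_on_subsequence[OF assms 1, of a] by auto
    then have "emb P (m i) (m j)" by (simp only: a) simp
    then show ?thesis using \<open>i < j\<close> by blast
  next
    case 2
    have "\<forall>i\<in>?N. \<exists>p. m i = Node (fst p) (snd p)" by auto
    then obtain p where p: "\<And>i. i \<in> ?N \<Longrightarrow> m i = Node (fst (p i)) (snd (p i))" by metis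
    have pS: "fst (p i) \<in> S" "snd (p i) \<in> S" if "i \<in> ?N" for i
      using p[OF that] by (auto simp: S_def child_def)
    obtain Y where Y: "Y \<subseteq> ?N" "infinite Y"
      "\<forall>i\<in>Y. \<forall>j\<in>Y. i < j \<longrightarrow> emb P (fst (p i)) (fst (p j))"
      using good_on_homogeneous[OF S 2, of "\<lambda>i. fst (p i)"] pS by blast
    obtain i j where "i \<in> Y" "j \<in> Y" "i < j" "emb P (snd (p i)) (snd (p j))"
      using good_on_subsequence[OF S Y(2), of "\<lambda>i. snd (p i)"] pS Y(1) by blast
    moreover from this have "m i = Node (fst (p i)) (snd (p i))" "m j = Node (fst (p j)) (snd (p j))"
      using p Y(1) by blast+
    ultimately have "emb P (m i) (m j)" using Y(3) by (metis emb.simps(4))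
    then show ?thesis using \<open>i < j\<close> by blast
  qed
  then show False using m by (auto simp: bad_def)
qed


section \<open>Boron trees are represented by binary trees\<close>

text \<open>
  The component of \<open>v\<close> after the edge between \<open>u\<close> and \<open>v\<close> has been deleted.
\<close>

definition branch :: "'v sgraph \<Rightarrow> 'v \<Rightarrow> 'v \<Rightarrow> 'v set" where
  "branch T u v = {x. (\<lambda>x y. {x, y} \<in> edges T \<and> {x, y} \<noteq> {u, v})\<^sup>*\<^sup>* v x}"

lemma branch_start: "v \<in> branch T u v"
  by (simp add: branch_def)

lemma branch_step:
  assumes "x \<in> branch T u v" "{x, y} \<in> edges T" "{x, y} \<noteq> {u, v}"
  shows "y \<in> branch T u v"
  using assms by (auto simp: branch_def intro: rtranclp.rtrancl_into_rtrancl)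

lemma branch_edge_iff:
  assumes "{x, y} \<in> edges T" "{x, y} \<noteq> {u, v}"
  shows "x \<in> branch T u v \<longleftrightarrow> y \<in> branch T u v"
  using branch_step[of x T u v y] branch_step[of y T u v x] assms by (auto simp: insert_commute)

lemma branch_least:
  assumes "v \<in> S" "\<And>x y. x \<in> S \<Longrightarrow> {x, y} \<in> edges T \<Longrightarrow> {x, y} \<noteq> {u, v} \<Longrightarrow> y \<in> S"
  shows "branch T u v \<subseteq> S"
proof
  fix x assume "x \<in> branch T u v"
  then have "(\<lambda>x y. {x, y} \<in> edges T \<and> {x, y} \<noteq> {u, v})\<^sup>*\<^sup>* v x" by (simp add: branch_def)
  then show "x \<in> S" by (induction rule: rtranclp_induct) (use assms in blast)+
qed

lemma rtranclp_distinct_path: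
  assumes "R\<^sup>*\<^sup>* a b"
  shows "\<exists>p. p \<noteq> [] \<and> hd p = a \<and> last p = b \<and> distinct p \<and> successively R p"
  using assms
proof (induction rule: rtranclp_induct)
  case base
  show ?case by (rule exI[of _ "[a]"]) simp
next
  case (step y z)
  then obtain p where p: "p \<noteq> []" "hd p = a" "last p = y" "distinct p" "successively R p" by blast
  show ?case
  proof (cases "z \<in> set p")
    case True
    then obtain p1 p2 where "p = p1 @ z # p2" by (auto simp: in_set_conv_decomp)
    then have "hd (p1 @ [z]) = a" "distinct (p1 @ [z])" "successively R (p1 @ [z])"
      using p by (auto simp: hd_append successively_append_iff)
    then show ?thesis by (intro exI[of _ "p1 @ [z]"]) simp
  next
    case False
    then have "hd (p @ [z]) = a" "distinct (p @ [z])" "successively R (p @ [z])"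
      using p step(2) by (auto simp: successively_append_iff)
    then show ?thesis by (intro exI[of _ "p @ [z]"]) simp
  qed
qed

lemma successively_same_side:
  assumes "successively R p" "\<And>x y. x \<in> set p \<Longrightarrow> y \<in> set p \<Longrightarrow> R x y \<Longrightarrow> x \<in> C \<longleftrightarrow> y \<in> C"
    and "x \<in> set p" "y \<in> set p"
  shows "x \<in> C \<longleftrightarrow> y \<in> C"
proof -
  have "set p \<subseteq> C \<or> set p \<inter> C = {}"
    using assms(1,2)
  proof (induction p)
    case (Cons a p)
    then have IH: "set p \<subseteq> C \<or> set p \<inter> C = {}" by (auto simp: successively_Cons)
    show ?case
    proof (cases p)
      case (Cons b q)
      then have "R a b" "b \<in> set p" using Cons.prems(1) by (simp_all add: successively_Cons)
      then have "a \<in> C \<longleftrightarrow> b \<in> C" using Cons.prems(2) by simp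
      then show ?thesis using IH \<open>b \<in> set p\<close> by auto
    qed auto
  qed simp
  then show ?thesis using assms(3,4) by blast
qed

lemma successively_exit:
  assumes "successively R p" "p \<noteq> []" "hd p \<in> C" "last p \<notin> C"
    and "\<And>x y. R x y \<Longrightarrow> x \<in> C \<Longrightarrow> y \<notin> C \<Longrightarrow> x = v"
  shows "v \<in> set (butlast p)"
  using assms(1-4)
proof (induction p)
  case (Cons a p)
  then have p: "p \<noteq> []" by auto
  have R: "R a (hd p)" "successively R p" using Cons.prems(1) p by (auto simp: successively_Cons)
  show ?case
  proof (cases "hd p \<in> C")
    case True
    then show ?thesis using Cons p R by auto
  next
    case False
    then show ?thesis using assms(5)[OF R(1)] Cons.prems(3) p by auto
  qed
qed simp

lemma successively_enter:
  assumes "successively R p" "p \<noteq> []" "hd p \<notin> C" "last p \<in> C"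
    and "\<And>x y. R x y \<Longrightarrow> x \<notin> C \<Longrightarrow> y \<in> C \<Longrightarrow> y = v"
  shows "v \<in> set (tl p)"
  using assms(1-4)
proof (induction p)
  case (Cons a p)
  then have p: "p \<noteq> []" by auto
  have R: "R a (hd p)" "successively R p" using Cons.prems(1) p by (auto simp: successively_Cons)
  show ?case
  proof (cases "hd p \<in> C")
    case True
    then have "hd p = v" using assms(5)[OF R(1)] Cons.prems(3) by simp
    then show ?thesis using p by (metis hd_in_set list.sel(3))
  next
    case False
    then have "v \<in> set (tl p)" using Cons p R by auto
    then show ?thesis using p by (metis list.sel(3) list.set_sel(2))
  qed
qed simp

locale tree_graph =
  fixes T :: "'v sgraph"
  assumes tree: "finite_tree T"
begin

abbreviation adj :: "'v \<Rightarrow> 'v \<Rightarrow> bool" where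
  "adj x y \<equiv> {x, y} \<in> edges T"

lemma adjD:
  assumes "adj x y"
  shows "x \<in> verts T" "y \<in> verts T" "x \<noteq> y" "adj y x"
proof -
  have *: "{x, y} \<subseteq> verts T" "card {x, y} = 2"
    using tree assms unfolding finite_tree_def by blast+
  then show "x \<in> verts T" "y \<in> verts T" by auto
  show "x \<noteq> y" using *(2) by auto
  show "adj y x" using assms by (simp add: insert_commute)
qed

text \<open>
  A path from \<open>v\<close> to \<open>u\<close> that avoids the edge would close up to a cycle. This is the form in
  which acyclicity is used below.
\<close>

lemma edge_bridge:
  assumes "adj u v"
  shows "u \<notin> branch T u v"
proof
  let ?R = "\<lambda>x y. adj x y \<and> {x, y} \<noteq> {u, v}"
  assume "u \<in> branch T u v"
  then have "?R\<^sup>*\<^sup>* v u" by (simp add: branch_def)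
  from rtranclp_distinct_path[OF this] obtain p
    where p: "p \<noteq> []" "hd p = v" "last p = u" "distinct p" "successively ?R p" by blast
  have "3 \<le> length p"
  proof (rule ccontr)
    assume "\<not> 3 \<le> length p"
    moreover have "length p \<noteq> 0" using p(1) by simp
    ultimately consider "length p = 1" | "length p = 2" by linarith
    then show False
    proof cases
      case 1
      then obtain a where "p = [a]" by (auto simp: length_Suc_conv)
      then show False using p(2,3) adjD(3)[OF assms] by simp
    next
      case 2
      then obtain a b where "p = [a, b]" by (auto simp: length_Suc_conv numeral_2_eq_2)
      then show False using p by auto
    qed
  qed
  moreover have "successively adj p" by (rule successively_mono[OF p(5)]) simp
  ultimately have "is_cycle T p" using p assms by (simp add: is_cycle_def)
  then show False using tree by (auto simp: finite_tree_def)
qed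

lemma branch_cover:
  assumes "adj u v" "x \<in> verts T"
  shows "x \<in> branch T u v \<or> x \<in> branch T v u"
proof -
  obtain p where p: "is_path T v p x"
    using tree assms adjD unfolding finite_tree_def by blast
  let ?S = "branch T u v \<union> branch T v u"
  have step: "y \<in> ?S" if "x \<in> ?S" "adj x y" for x y
  proof (cases "{x, y} = {u, v}")
    case True
    then show ?thesis using branch_start[of u T v] branch_start[of v T u] by (auto simp: doubleton_eq_iff)
  next
    case False
    then show ?thesis using that branch_step[of x T u v y] branch_step[of x T v u y]
      by (auto simp: insert_commute)
  qed
  have "v \<in> ?S \<longleftrightarrow> x \<in> ?S"
  proof (rule successively_same_side[of adj p])
    show "successively adj p" using p by (simp add: is_path_def)
    show "v \<in> set p" "x \<in> set p" using p by (auto simp: is_path_def)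
  qed (use step adjD(4) in blast)
  then show ?thesis using branch_start[of v T u] by simp
qed

text \<open>
  A walk that starts at \<open>b\<close> and does not use the edge between \<open>a\<close> and \<open>b\<close> stays in the branch
  and so never meets \<open>w\<close>; hence \<open>S\<close> need only be closed under edges that avoid \<open>w\<close>.
\<close>

lemma branch_subset_avoiding:
  assumes "w \<notin> branch T a b" "\<And>x y. x \<in> S \<Longrightarrow> adj x y \<Longrightarrow> x \<noteq> w \<Longrightarrow> y \<noteq> w \<Longrightarrow> y \<in> S" "b \<in> S"
  shows "branch T a b \<subseteq> S"
proof -
  have "branch T a b \<subseteq> S \<inter> branch T a b"
  proof (rule branch_least)
    show "b \<in> S \<inter> branch T a b" using assms(3) branch_start by auto
    fix x y assume *: "x \<in> S \<inter> branch T a b" "adj x y" "{x, y} \<noteq> {a, b}"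
    then have "y \<in> branch T a b" using branch_step by fast
    then show "y \<in> S \<inter> branch T a b" using * assms(1,2) by blast
  qed
  then show ?thesis by blast
qed

lemma branch_disjoint:
  assumes "adj u v"
  shows "branch T u v \<inter> branch T v u = {}"
proof -
  have "branch T u v \<subseteq> - branch T v u"
  proof (rule branch_least)
    show "v \<in> - branch T v u" using edge_bridge adjD(4)[OF assms] by simp
    fix x y assume "x \<in> - branch T v u" "adj x y" "{x, y} \<noteq> {u, v}"
    then show "y \<in> - branch T v u" using branch_edge_iff[of x y T v u] by (auto simp: insert_commute)
  qed
  then show ?thesis by blast
qed

lemma branch_compl:
  assumes "adj u v" "x \<in> verts T"
  shows "x \<in> branch T v u \<longleftrightarrow> x \<notin> branch T u v"
  using branch_cover[OF assms] branch_disjoint[OF assms(1)] by blast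

lemma branch_subset_verts:
  assumes "adj u v"
  shows "branch T u v \<subseteq> verts T"
  by (rule branch_least) (use assms adjD in auto)

lemma branch_crossing:
  assumes "adj x y" "x \<in> branch T u v" "y \<notin> branch T u v" "adj u v"
  shows "x = v \<and> y = u"
proof -
  have "{x, y} = {u, v}" using branch_edge_iff[OF assms(1)] assms(2,3) by blast
  then show ?thesis using assms edge_bridge by (auto simp: doubleton_eq_iff)
qed

text \<open>
  A path that leaves the branch can do so only through \<open>v\<close>, and must come back through \<open>v\<close>; but it visits
  \<open>v\<close> only once.
\<close>

lemma path_in_branch:
  assumes uv: "adj u v" and p: "is_path T w p x" and wx: "w \<in> branch T u v" "x \<in> branch T u v"
  shows "set p \<subseteq> branch T u v"
proof (rule ccontr)
  assume "\<not> ?thesis"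
  then obtain z where z: "z \<in> set p" "z \<notin> branch T u v" by blast
  then obtain p1 p2 where pz: "p = p1 @ z # p2" by (auto simp: in_set_conv_decomp)
  have s: "successively adj (p1 @ [z])" "successively adj (z # p2)" "distinct p"
    "hd p = w" "last p = x"
    using p by (auto simp: is_path_def pz successively_append_iff)
  have "v \<in> set (butlast (p1 @ [z]))"
    by (rule successively_exit[OF s(1), where C = "branch T u v"])
      (use s(4) z wx pz branch_crossing[OF _ _ _ uv] in \<open>auto simp: hd_append\<close>)
  moreover have "v \<in> set (tl (z # p2))"
    by (rule successively_enter[OF s(2), where C = "branch T u v"])
      (use s(5) z wx pz branch_crossing[OF adjD(4) _ _ uv] in \<open>auto\<close>)
  ultimately show False using s(3) pz by auto
qed

lemma branch_contains_connected:
  assumes "successively adj p" "x \<in> set p" "x \<in> branch T u v" "\<not> {u, v} \<subseteq> set p"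
  shows "set p \<subseteq> branch T u v"
proof
  fix y assume "y \<in> set p"
  have "x \<in> branch T u v \<longleftrightarrow> y \<in> branch T u v"
  proof (rule successively_same_side[OF assms(1) _ assms(2) \<open>y \<in> set p\<close>])
    fix a b assume "a \<in> set p" "b \<in> set p" "adj a b"
    then show "a \<in> branch T u v \<longleftrightarrow> b \<in> branch T u v"
      using branch_edge_iff[of a b T u v] assms(4) by (metis empty_subsetI insert_subset)
  qed
  then show "y \<in> branch T u v" using assms(3) by simp
qed

text \<open>
  Paths on different sides of an edge are disjoint. Conversely, for disjoint paths \<open>p\<close> and \<open>q\<close>, a path \<open>r\<close>
  from \<open>p\<close> to \<open>q\<close> leaves \<open>p\<close> for the last time along some edge, and this edge separates \<open>p\<close> from \<open>q\<close>:
  neither path contains both of its ends.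
\<close>

theorem not_rho_iff_separating_edge:
  assumes V: "w \<in> verts T" "x \<in> verts T" "y \<in> verts T" "z \<in> verts T"
  shows "\<not> rho T w x y z \<longleftrightarrow> (\<exists>u v. adj u v \<and>
    w \<in> branch T u v \<and> x \<in> branch T u v \<and> y \<notin> branch T u v \<and> z \<notin> branch T u v)"
proof
  assume "\<exists>u v. adj u v \<and>
    w \<in> branch T u v \<and> x \<in> branch T u v \<and> y \<notin> branch T u v \<and> z \<notin> branch T u v"
  then obtain u v where uv: "adj u v" and b: "w \<in> branch T u v" "x \<in> branch T u v"
    "y \<in> branch T v u" "z \<in> branch T v u"
    using branch_compl V by blast
  have "geodesic T w x \<subseteq> branch T u v" "geodesic T y z \<subseteq> branch T v u"
    using path_in_branch[OF uv _ b(1,2)] path_in_branch[OF adjD(4)[OF uv] _ b(3,4)]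
    by (auto simp: geodesic_def)
  then show "\<not> rho T w x y z" using branch_disjoint[OF uv] unfolding rho_def by blast
next
  assume "\<not> rho T w x y z"
  have path: "\<exists>p. is_path T a p b" if "a \<in> verts T" "b \<in> verts T" for a b
    using tree that unfolding finite_tree_def by blast
  obtain p where p: "is_path T w p x" using path V by blast
  obtain q where q: "is_path T y q z" using path V by blast
  obtain r where r: "is_path T w r y" using path V by blast
  have pq: "set p \<inter> set q = {}"
    using \<open>\<not> rho T w x y z\<close> p q unfolding rho_def geodesic_def by blast
  have pe: "w \<in> set p" "x \<in> set p" and qe: "y \<in> set q" "z \<in> set q"
    using p q by (auto simp: is_path_def)
  have re: "w \<in> set r" "last r = y" using r by (auto simp: is_path_def)
  have "\<exists>a\<in>set r. a \<in> set p" using pe re by blast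
  then obtain r1 b r2 where rb: "r = r1 @ b # r2" "b \<in> set p" "\<forall>c\<in>set r2. c \<notin> set p"
    by (rule split_list_last_propE)
  have "r2 \<noteq> []" using rb re(2) pq qe by auto
  then obtain a r3 where ra: "r2 = a # r3" by (cases r2) auto
  have succ: "successively adj (a # r3)" "adj b a" "last (a # r3) = y"
    using r rb(1) ra by (auto simp: is_path_def successively_append_iff)
  have ab: "adj a b" using adjD(4)[OF succ(2)] .
  have a: "a \<notin> set p" using rb(3) ra by simp
  have P: "set p \<subseteq> branch T a b"
    by (rule branch_contains_connected[of p b]) (use p rb(2) a branch_start in \<open>auto simp: is_path_def\<close>)
  have "set (a # r3) \<subseteq> branch T b a"
    by (rule branch_contains_connected[of _ a]) (use succ(1) rb branch_start ra in auto)
  then have "y \<in> branch T b a" using succ(3) last_in_set[of "a # r3"] by auto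
  then have Q: "set q \<subseteq> branch T b a"
    by (intro branch_contains_connected[of q y])
      (use q qe pq rb(2) in \<open>auto simp: is_path_def\<close>)
  show "\<exists>u v. adj u v \<and>
    w \<in> branch T u v \<and> x \<in> branch T u v \<and> y \<notin> branch T u v \<and> z \<notin> branch T u v"
    using ab P Q pe qe branch_disjoint[OF ab] by blast
qed

definition hbranch :: "'v \<Rightarrow> 'v \<Rightarrow> 'v set" where
  "hbranch u v = hydrogens T \<inter> branch T u v"

lemma branch_hydrogen:
  assumes uv: "adj u v" and v: "v \<in> hydrogens T"
  shows "branch T u v = {v}"
proof -
  have "verts T \<noteq> {v}" using adjD[OF uv] by auto
  then have "card {e \<in> edges T. v \<in> e} = 1" using v by (auto simp: hydrogens_def valence_def)
  then obtain e0 where e0: "{e \<in> edges T. v \<in> e} = {e0}" by (auto simp: card_1_singleton_iff)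
  have "e = e0" if "e \<in> edges T" "v \<in> e" for e
    using that e0[THEN equalityD1] by blast
  then have only: "e = {u, v}" if "e \<in> edges T" "v \<in> e" for e
    using uv that by blast
  have "branch T u v \<subseteq> {v}" by (rule branch_least) (use only in auto)
  then show ?thesis using branch_start[of v T u] by auto
qed

lemma boron_neighbours:
  assumes uv: "adj u v" and v: "valence T v = 3"
  shows "\<exists>a b. adj v a \<and> adj v b \<and> a \<noteq> b \<and> a \<noteq> u \<and> b \<noteq> u \<and> (\<forall>c. adj v c \<longrightarrow> c \<in> {u, a, b})"
proof -
  let ?E = "{e \<in> edges T. v \<in> e}"
  have "card (?E - {{u, v}}) = 2" using uv v by (simp add: valence_def)
  then obtain e f where ef: "?E - {{u, v}} = {e, f}" "e \<noteq> f" by (auto simp: card_2_iff)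
  have nb: "\<exists>a. e = {v, a}" if "e \<in> ?E" for e
  proof -
    have "card e = 2" using tree that by (auto simp: finite_tree_def)
    then show ?thesis using that by (auto simp: card_2_iff)
  qed
  have E: "e \<in> ?E" "f \<in> ?E" "e \<noteq> {u, v}" "f \<noteq> {u, v}" using ef(1) by blast+
  obtain a where a: "e = {v, a}" using nb[OF E(1)] by blast
  obtain b where b: "f = {v, b}" using nb[OF E(2)] by blast
  have "adj v a" "adj v b" using E a b by simp_all
  moreover have "a \<noteq> b" using ef(2) a b by blast
  moreover have "a \<noteq> u" "b \<noteq> u" using E(3,4) a b by (metis insert_commute)+
  moreover have "c \<in> {u, a, b}" if "adj v c" for c
  proof -
    have "{v, c} \<in> insert {u, v} (?E - {{u, v}})" using that by simp
    then have "{v, c} \<in> {{u, v}, {v, a}, {v, b}}" by (simp only: ef(1) a b)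
    then show ?thesis by (auto simp: doubleton_eq_iff)
  qed
  ultimately show ?thesis by blast
qed

lemma branch_boron:
  assumes uv: "adj u v" and va: "adj v a" and vb: "adj v b"
    and ne: "a \<noteq> b" "a \<noteq> u" "b \<noteq> u" and only: "\<And>c. adj v c \<Longrightarrow> c \<in> {u, a, b}"
  shows "branch T u v = insert v (branch T v a \<union> branch T v b)"
    and "branch T v a \<inter> branch T v b = {}"
    and "v \<notin> branch T v a" "v \<notin> branch T v b"
proof -
  show nv: "v \<notin> branch T v a" "v \<notin> branch T v b" using edge_bridge va vb by auto
  have sub: "branch T v c \<subseteq> branch T d v" if "adj v c" "c \<noteq> d" "v \<noteq> d" for c d
  proof (rule branch_subset_avoiding[where w = v])
    show "v \<notin> branch T v c" by (rule edge_bridge[OF that(1)])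
    show "c \<in> branch T d v"
      using branch_step[OF branch_start that(1)] that(2,3) by (auto simp: doubleton_eq_iff)
    show "y \<in> branch T d v" if "x \<in> branch T d v" "adj x y" "x \<noteq> v" "y \<noteq> v" for x y
      using branch_step[OF that(1,2)] that(3,4) by (auto simp: doubleton_eq_iff)
  qed
  show "branch T v a \<inter> branch T v b = {}"
    using sub[OF vb ne(1)[symmetric] adjD(3)[OF va]] branch_disjoint[OF adjD(4)[OF va]] by blast
  show "branch T u v = insert v (branch T v a \<union> branch T v b)"
  proof
    show "insert v (branch T v a \<union> branch T v b) \<subseteq> branch T u v"
      using sub[OF va ne(2) adjD(3)[OF adjD(4)[OF uv]]] sub[OF vb ne(3) adjD(3)[OF adjD(4)[OF uv]]]
        branch_start[of v T u] by blast
    show "branch T u v \<subseteq> insert v (branch T v a \<union> branch T v b)"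
    proof (rule branch_least)
      fix x y assume x: "x \<in> insert v (branch T v a \<union> branch T v b)" "adj x y" "{x, y} \<noteq> {u, v}"
      show "y \<in> insert v (branch T v a \<union> branch T v b)"
      proof (cases "x = v")
        case True
        then have "y = a \<or> y = b" using only[of y] x by auto
        then show ?thesis using branch_start[of a T v] branch_start[of b T v] by auto
      next
        case False
        then show ?thesis using x branch_crossing[OF x(2) _ _ va] branch_crossing[OF x(2) _ _ vb]
          by blast
      qed
    qed simp
  qed
qed

text \<open>
  Only edges with both ends inside the branch are counted in the last condition. The edge between \<open>u\<close>
  and \<open>v\<close> is covered too, since its cluster is the full leaf set.
\<close>

definition represents_branch :: "'v btree \<Rightarrow> 'v \<Rightarrow> 'v \<Rightarrow> bool" where
  "represents_branch t u v \<longleftrightarrow> distinct (leaves t) \<and> set_btree t = hbranch u v \<and>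
    (\<forall>C\<in>clusters t. \<exists>a b. adj a b \<and> C = hbranch a b) \<and>
    (\<forall>a b. adj a b \<longrightarrow> a \<in> branch T u v \<longrightarrow> b \<in> branch T u v \<longrightarrow>
      hbranch a b \<in> clusters t \<or> hbranch b a \<in> clusters t)"

lemma represents_branchD:
  assumes "represents_branch t u v"
  shows "distinct (leaves t)" "set_btree t = hbranch u v"
    "C \<in> clusters t \<Longrightarrow> \<exists>a b. adj a b \<and> C = hbranch a b"
    "adj a b \<Longrightarrow> a \<in> branch T u v \<Longrightarrow> b \<in> branch T u v \<Longrightarrow>
      hbranch a b \<in> clusters t \<or> hbranch b a \<in> clusters t"
    "hbranch u v \<in> clusters t"
proof -
  note * = assms[unfolded represents_branch_def]
  show "distinct (leaves t)" and st: "set_btree t = hbranch u v"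
    by (rule conjunct1[OF *], rule conjunct1[OF conjunct2[OF *]])
  show "C \<in> clusters t \<Longrightarrow> \<exists>a b. adj a b \<and> C = hbranch a b"
    using *[THEN conjunct2, THEN conjunct2, THEN conjunct1] by (rule bspec)
  show "adj a b \<Longrightarrow> a \<in> branch T u v \<Longrightarrow> b \<in> branch T u v \<Longrightarrow>
      hbranch a b \<in> clusters t \<or> hbranch b a \<in> clusters t"
    using *[THEN conjunct2, THEN conjunct2, THEN conjunct2, rule_format] .
  show "hbranch u v \<in> clusters t" using set_btree_in_clusters[of t] by (simp only: st)
qed

text \<open>
  A branch that ends in a hydrogen atom is a leaf. Otherwise its first vertex \<open>v\<close> has exactly two
  further neighbours, and the branches towards them, which are smaller, give the two subtrees.
\<close>

lemma branch_btree:
  assumes boron: "boron_tree T" and uv: "adj u v"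
  shows "\<exists>t. represents_branch t u v"
  using uv
proof (induction "card (branch T u v)" arbitrary: u v rule: less_induct)
  case less
  have v: "v \<in> verts T" using adjD less.prems by blast
  show ?case
  proof (cases "v \<in> hydrogens T")
    case True
    have b: "branch T u v = {v}" by (rule branch_hydrogen[OF less.prems True])
    have h: "hbranch u v = {v}" using True by (simp add: hbranch_def b)
    have "\<not> (adj a b \<and> a \<in> branch T u v \<and> b \<in> branch T u v)" for a b
      using adjD(3)[of a b] by (auto simp: b)
    moreover have "\<exists>a b. adj a b \<and> {v} = hbranch a b" using less.prems h by blast
    ultimately have "represents_branch (Leaf v) u v"
      unfolding represents_branch_def by (simp add: h)
    then show ?thesis by blast
  next
    case False
    then have "valence T v = 3" using boron v by (simp add: boron_tree_def)
    from boron_neighbours[OF less.prems this] obtain a b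
      where ab: "adj v a" "adj v b" "a \<noteq> b" "a \<noteq> u" "b \<noteq> u" "\<And>c. adj v c \<Longrightarrow> c \<in> {u, a, b}"
      by blast
    note br = branch_boron[OF less.prems ab]
    have fin: "finite (branch T u v)"
      using branch_subset_verts[OF less.prems] tree by (meson finite_subset finite_tree_def)
    have card: "card (branch T v a) < card (branch T u v)" "card (branch T v b) < card (branch T u v)"
      by (rule psubset_card_mono[OF fin], use br in blast)+
    obtain s where s: "represents_branch s v a" using less.hyps[OF card(1) ab(1)] by blast
    note s = represents_branchD[OF s]
    obtain t where t: "represents_branch t v b" using less.hyps[OF card(2) ab(2)] by blast
    note t = represents_branchD[OF t]
    have un: "hbranch v a \<union> hbranch v b = hbranch u v"
      using False by (auto simp: hbranch_def br(1))
    have cl: "clusters (Node s t) = insert (hbranch u v) (clusters s \<union> clusters t)"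
      by (simp add: s(2) t(2) un)
    have "represents_branch (Node s t) u v"
      unfolding represents_branch_def
    proof (intro conjI ballI allI impI)
      show "distinct (leaves (Node s t))"
        using s(1,2) t(1,2) br(2) by (auto simp: hbranch_def)
      show "set_btree (Node s t) = hbranch u v" by (simp add: s(2) t(2) un)
      show "\<exists>a b. adj a b \<and> C = hbranch a b" if "C \<in> clusters (Node s t)" for C
        using that s(3) t(3) less.prems unfolding cl by blast
      fix c d assume cd: "adj c d" "c \<in> branch T u v" "d \<in> branch T u v"
      have vc: "hbranch v c \<in> clusters s \<union> clusters t" if "adj v c" "c \<in> branch T u v" for c
        using ab(6)[OF that(1)] that(2) edge_bridge[OF less.prems] s(5) t(5) by auto
      have cd': "c \<in> insert v (branch T v a \<union> branch T v b)" "d \<in> insert v (branch T v a \<union> branch T v b)"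
        using cd(2,3) by (simp_all only: br(1))
      consider "c = v" | "d = v" | "c \<in> branch T v a" "d \<in> branch T v a"
        | "c \<in> branch T v b" "d \<in> branch T v b"
        using cd' branch_crossing[OF cd(1) _ _ ab(1)] branch_crossing[OF cd(1) _ _ ab(2)]
          branch_crossing[OF adjD(4)[OF cd(1)] _ _ ab(1)] branch_crossing[OF adjD(4)[OF cd(1)] _ _ ab(2)]
        by blast
      then show "hbranch c d \<in> clusters (Node s t) \<or> hbranch d c \<in> clusters (Node s t)"
      proof cases
        case 1
        then show ?thesis using vc[of d] cd unfolding cl by blast
      next
        case 2
        then show ?thesis using vc[of c] cd adjD(4)[OF cd(1)] unfolding cl by blast
      next
        case 3
        then show ?thesis using s(4)[OF cd(1)] unfolding cl by blast
      next
        case 4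
        then show ?thesis using t(4)[OF cd(1)] unfolding cl by blast
      qed
    qed
    then show ?thesis by blast
  qed
qed

end

text \<open>
  The root is placed on an arbitrary edge, so the two branches of that edge give the two subtrees.
  A tree without edges has a single vertex and is represented by a leaf.
\<close>

theorem boron_tree_btree:
  assumes boron: "boron_tree T"
  shows "\<exists>t. distinct (leaves t) \<and> set_btree t = hydrogens T \<and>
    (\<forall>w\<in>hydrogens T. \<forall>x\<in>hydrogens T. \<forall>y\<in>hydrogens T. \<forall>z\<in>hydrogens T.
      rho T w x y z \<longleftrightarrow> leaf_rho t w x y z)"
proof -
  interpret tree_graph T by standard (use boron in \<open>simp add: boron_tree_def\<close>)
  have HV: "hydrogens T \<subseteq> verts T" by (auto simp: hydrogens_def)
  have "\<exists>t. distinct (leaves t) \<and> set_btree t = hydrogens T \<and>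
     (\<forall>C\<in>clusters t. C = hydrogens T \<or> (\<exists>a b. adj a b \<and> C = hbranch a b)) \<and>
     (\<forall>a b. adj a b \<longrightarrow> hbranch a b \<in> clusters t \<or> hbranch b a \<in> clusters t)"
  proof (cases "\<exists>u v. adj u v")
    case True
    then obtain u v where uv: "adj u v" by blast
    note vu = adjD(4)[OF uv]
    obtain s where s: "represents_branch s u v" using branch_btree[OF boron uv] by blast
    note s = represents_branchD[OF s]
    obtain t where t: "represents_branch t v u" using branch_btree[OF boron vu] by blast
    note t = represents_branchD[OF t]
    have un: "hbranch u v \<union> hbranch v u = hydrogens T"
      using branch_cover[OF uv] HV by (auto simp: hbranch_def)
    have cl: "clusters (Node s t) = insert (hydrogens T) (clusters s \<union> clusters t)"
      by (simp add: s(2) t(2) un)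
    show ?thesis
    proof (intro exI[of _ "Node s t"] conjI ballI allI impI)
      show "distinct (leaves (Node s t))"
        using s(1,2) t(1,2) branch_disjoint[OF uv] by (auto simp: hbranch_def)
      show "set_btree (Node s t) = hydrogens T" by (simp add: s(2) t(2) un)
      show "C = hydrogens T \<or> (\<exists>a b. adj a b \<and> C = hbranch a b)" if "C \<in> clusters (Node s t)" for C
        using that s(3) t(3) unfolding cl by blast
      fix c d assume cd: "adj c d"
      consider "{c, d} = {u, v}" | "c \<in> branch T u v" "d \<in> branch T u v"
        | "c \<in> branch T v u" "d \<in> branch T v u"
        using branch_edge_iff[OF cd, of u v] branch_compl[OF uv] adjD(1,2)[OF cd] by blast
      then show "hbranch c d \<in> clusters (Node s t) \<or> hbranch d c \<in> clusters (Node s t)"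
      proof cases
        case 1
        then show ?thesis using s(5) unfolding cl by (auto simp: doubleton_eq_iff)
      next
        case 2
        then show ?thesis using s(4)[OF cd] unfolding cl by blast
      next
        case 3
        then show ?thesis using t(4)[OF cd] unfolding cl by blast
      qed
    qed
  next
    case False
    obtain v where v: "v \<in> verts T" using tree by (auto simp: finite_tree_def)
    have "x = v" if x: "x \<in> verts T" for x
    proof -
      obtain p where p: "is_path T v p x" using tree v x unfolding finite_tree_def by blast
      have "v \<in> {v} \<longleftrightarrow> x \<in> {v}"
        by (rule successively_same_side[of adj p])
          (use p False in \<open>auto simp: is_path_def\<close>)
      then show ?thesis by simp
    qed
    then have "verts T = {v}" using v by blast
    then have "hydrogens T = {v}" by (auto simp: hydrogens_def)
    then show ?thesis using False by (intro exI[of _ "Leaf v"]) auto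
  qed
  then obtain t where t: "distinct (leaves t)" "set_btree t = hydrogens T"
    "\<forall>C\<in>clusters t. C = hydrogens T \<or> (\<exists>a b. adj a b \<and> C = hbranch a b)"
    "\<forall>a b. adj a b \<longrightarrow> hbranch a b \<in> clusters t \<or> hbranch b a \<in> clusters t"
    by (elim exE conjE)
  have "rho T w x y z \<longleftrightarrow> leaf_rho t w x y z"
    if H: "w \<in> hydrogens T" "x \<in> hydrogens T" "y \<in> hydrogens T" "z \<in> hydrogens T" for w x y z
  proof -
    have HV': "w \<in> verts T" "x \<in> verts T" "y \<in> verts T" "z \<in> verts T" using H HV by blast+
    have flip: "separates (hbranch b a) w x y z \<longleftrightarrow> separates (hbranch a b) w x y z" if "adj a b" for a b
      using branch_compl[OF that HV'(1)] branch_compl[OF that HV'(2)] branch_compl[OF that HV'(3)]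
          branch_compl[OF that HV'(4)] H by (auto simp: separates_def hbranch_def)
    have "\<not> rho T w x y z \<longleftrightarrow> (\<exists>a b. adj a b \<and>
        w \<in> branch T a b \<and> x \<in> branch T a b \<and> y \<notin> branch T a b \<and> z \<notin> branch T a b)"
      by (rule not_rho_iff_separating_edge[OF HV'])
    also have "\<dots> \<longleftrightarrow> (\<exists>a b. adj a b \<and> separates (hbranch a b) w x y z)"
    proof -
      have 1: "separates (hbranch a b) w x y z \<longleftrightarrow>
         (w \<in> branch T a b \<and> x \<in> branch T a b \<and> y \<notin> branch T a b \<and> z \<notin> branch T a b) \<or>
         (w \<in> branch T b a \<and> x \<in> branch T b a \<and> y \<notin> branch T b a \<and> z \<notin> branch T b a)"
        if "adj a b" for a b
        using branch_compl[OF that HV'(1)] branch_compl[OF that HV'(2)] branch_compl[OF that HV'(3)]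
          branch_compl[OF that HV'(4)] H by (auto simp: separates_def hbranch_def)
      show ?thesis using 1 adjD(4) by blast
    qed
    also have "\<dots> \<longleftrightarrow> (\<exists>C\<in>clusters t. separates C w x y z)"
    proof
      assume "\<exists>a b. adj a b \<and> separates (hbranch a b) w x y z"
      then show "\<exists>C\<in>clusters t. separates C w x y z" using t(4) flip by blast
    next
      assume "\<exists>C\<in>clusters t. separates C w x y z"
      moreover have "\<not> separates (hydrogens T) w x y z" using H by (auto simp: separates_def)
      ultimately show "\<exists>a b. adj a b \<and> separates (hbranch a b) w x y z" using t(3) by metis
    qed
    finally show ?thesis by (auto simp: leaf_rho_def)
  qed
  then show ?thesis using t(1,2) by blast
qed


section \<open>The category of binary trees with sorted leaf labels\<close>

abbreviation tree_of :: "nat \<Rightarrow> nat btree" where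
  "tree_of \<equiv> from_nat"

definition leaf_set :: "nat \<Rightarrow> nat set" where
  "leaf_set k = set_btree (tree_of k)"

text \<open>
  The second component makes the morphisms increasing for the order of the leaf labels.
\<close>

definition leaf_val :: "nat \<Rightarrow> nat \<Rightarrow> nat \<Rightarrow> nat \<Rightarrow> nat \<Rightarrow> bool \<times> bool" where
  "leaf_val k w x y z = (leaf_rho (tree_of k) w x y z, w < x)"

definition leaf_enc :: "nat \<Rightarrow> (nat \<Rightarrow> nat) \<Rightarrow> nat" where
  "leaf_enc k f = to_nat (map (\<lambda>x. (x, f x)) (leaves (tree_of k)))"

definition leaf_dec :: "nat \<Rightarrow> nat \<Rightarrow> nat \<Rightarrow> nat" where
  "leaf_dec k m = (\<lambda>x\<in>leaf_set k. the (map_of (from_nat m) x))"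

text \<open>
  The parameter \<open>S\<close> allows the category to be restricted to those trees that come from boron trees. When
  the labels of each tree increase from left to right, the order of the labels is the planar order.
\<close>

definition leaf_category :: "nat btree set \<Rightarrow> (nat, nat) category" where
  "leaf_category S = str_category (to_nat ` S) leaf_set leaf_val leaf_enc leaf_dec"

definition leaf_functor :: "(nat, nat, nat) to_FI" where
  "leaf_functor = str_functor leaf_set leaf_dec"

lemma leaf_dec_enc:
  assumes "f \<in> extensional (leaf_set k)"
  shows "leaf_dec k (leaf_enc k f) = f"
proof
  fix x
  show "leaf_dec k (leaf_enc k f) x = f x"
  proof (cases "x \<in> leaf_set k")
    case True
    then show ?thesis
      by (simp add: leaf_dec_def leaf_enc_def map_of_map_restrict leaf_set_def)
  next
    case False
    then show ?thesis using assms by (simp add: leaf_dec_def extensional_def)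
  qed
qed

lemma leaf_hom_dec:
  assumes "m \<in> Hom (leaf_category S) k l"
  shows "leaf_dec k m \<in> str_hom leaf_set leaf_val k l"
proof -
  obtain f where "f \<in> str_hom leaf_set leaf_val k l" "m = leaf_enc k f"
    using assms by (auto simp: leaf_category_def str_category_def)
  then show ?thesis using leaf_dec_enc str_hom_ext by metis
qed

lemma leaf_hom_mono:
  assumes "f \<in> str_hom leaf_set leaf_val k l" "x \<in> leaf_set k" "y \<in> leaf_set k"
  shows "f x < f y \<longleftrightarrow> x < y"
proof -
  have "leaf_val k x y x x = leaf_val l (f x) (f y) (f x) (f x)"
    using assms unfolding str_hom_def by blast
  then show ?thesis by (simp add: leaf_val_def)
qed

lemma leaf_map_str_hom:
  assumes f: "leaf_map P (tree_of k) (tree_of l) f"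
  shows "restrict f (leaf_set k) \<in> str_hom leaf_set leaf_val k l"
proof -
  note D = leaf_mapD[OF f, folded leaf_set_def]
  have less: "f x < f y \<longleftrightarrow> x < y" if "x \<in> leaf_set k" "y \<in> leaf_set k" for x y
    using strict_mono_on_less[OF D(3) that] .
  have "inj_on f (leaf_set k)" by (rule strict_mono_on_imp_inj_on[OF D(3)])
  then show ?thesis
    using D(1) less leaf_map_rho[OF f, folded leaf_set_def]
    by (simp add: str_hom_def inj_on_restrict_eq leaf_val_def)
qed

text \<open>
  The labels of the trees are replaced by their weights before Kruskal's theorem is applied, so that one
  relation compares all members of the sequence; \<open>emb_map\<close> brings the labels back.
\<close>

lemma leaf_category_wqo:
  fixes s :: "nat \<Rightarrow> nat \<times> (nat \<Rightarrow> nat)"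
  assumes S: "\<And>t. t \<in> S \<Longrightarrow> sorted_wrt (<) (leaves t)"
    and s: "range s \<subseteq> Ob (weighted (leaf_category S) leaf_functor)"
  shows "\<exists>i j. i < j \<and> Hom (weighted (leaf_category S) leaf_functor) (s i) (s j) \<noteq> {}"
proof -
  define k where "k i = fst (s i)" for i :: nat
  define \<alpha> where "\<alpha> i = snd (s i)" for i
  have si: "s i = (k i, \<alpha> i)" for i by (simp add: k_def \<alpha>_def)
  have ob: "k i \<in> to_nat ` S" for i
  proof -
    have "(k i, \<alpha> i) \<in> Ob (weighted (leaf_category S) leaf_functor)" using s si by (metis rangeI subsetD)
    then show ?thesis by (simp add: weighted_def leaf_category_def str_category_def)
  qed
  have sorted: "sorted_wrt (<) (leaves (tree_of (k i)))" for i
  proof -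
    obtain t where "k i = to_nat t" "t \<in> S" using ob[of i] by (rule imageE)
    then show ?thesis using S by simp
  qed
  obtain i j where ij: "i < j"
    and emb: "emb (\<le>) (map_btree (\<alpha> i) (tree_of (k i))) (map_btree (\<alpha> j) (tree_of (k j)))"
    using kruskal_btree[OF good_on_le_nat, unfolded good_on_def, rule_format,
        of "\<lambda>i. map_btree (\<alpha> i) (tree_of (k i))"] by auto
  obtain f where f: "leaf_map (\<lambda>x y. \<alpha> i x \<le> \<alpha> j y) (tree_of (k i)) (tree_of (k j)) f"
    using emb_imp_leaf_map[OF emb[unfolded emb_map] sorted sorted] by blast
  let ?f = "restrict f (leaf_set (k i))"
  have hom: "?f \<in> str_hom leaf_set leaf_val (k i) (k j)" by (rule leaf_map_str_hom[OF f])
  have "leaf_dec (k i) (leaf_enc (k i) ?f) = ?f" by (rule leaf_dec_enc) simp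
  then have "leaf_enc (k i) ?f \<in> Hom (weighted (leaf_category S) leaf_functor) (s i) (s j)"
    using hom leaf_mapD(2)[OF f, folded leaf_set_def]
    by (simp add: si weighted_def leaf_category_def str_category_def leaf_functor_def str_functor_def)
  then show ?thesis using ij by blast
qed

theorem G_category_leaf_category:
  assumes S: "\<And>t. t \<in> S \<Longrightarrow> sorted_wrt (<) (leaves t)"
  shows "G_category (leaf_category S) leaf_functor"
proof -
  have FI: "FI_concrete (leaf_category S) leaf_functor"
    unfolding leaf_category_def leaf_functor_def
    by (rule FI_concrete_str_category) (simp_all add: leaf_dec_enc leaf_set_def)
  have "orderable (leaf_category S) leaf_functor"
    unfolding orderable_def
  proof (intro exI conjI ballI)
    let ?r = "\<lambda>k. {(x, y). x \<in> leaf_set k \<and> y \<in> leaf_set k \<and> x \<le> y}"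
    show "linear_order_on (obj_map leaf_functor k) (?r k)" for k
      by (auto simp: leaf_functor_def str_functor_def linear_order_on_def partial_order_on_def
          preorder_on_def refl_on_def trans_def antisym_def total_on_def)
    fix k l m p
    assume m: "m \<in> Hom (leaf_category S) k l" and p: "p \<in> ?r k"
    obtain x y where xy: "p = (x, y)" "x \<in> leaf_set k" "y \<in> leaf_set k" "x \<le> y" using p by auto
    note h = leaf_hom_dec[OF m]
    have "leaf_dec k m x \<in> leaf_set l" "leaf_dec k m y \<in> leaf_set l"
      using h xy(2,3) by (auto simp: str_hom_def)
    moreover have "leaf_dec k m x \<le> leaf_dec k m y"
      using leaf_hom_mono[OF h xy(3,2)] xy(4) by simp
    ultimately show "case p of (x, y) \<Rightarrow>
        (mor_map leaf_functor k l m x, mor_map leaf_functor k l m y) \<in> ?r l"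
      by (simp add: xy(1) leaf_functor_def str_functor_def)
  qed
  moreover have "wqo_on (weighted_le (leaf_category S) leaf_functor)
      (weighted_classes (leaf_category S) leaf_functor)"
    by (rule weighted_classes_wqo[OF FI leaf_category_wqo]) (use S in auto)
  ultimately show ?thesis using FI by (simp add: G_category_def)
qed


section \<open>From binary trees to boron trees\<close>

text \<open>
  The map \<open>g\<close> identifies the unrooted tree underlying \<open>t\<close> with the boron tree \<open>T\<close>, as far as leaves and
  \<open>\<rho>\<close> are concerned.
\<close>

definition charts :: "nat btree \<Rightarrow> 'v sgraph \<Rightarrow> (nat \<Rightarrow> 'v) \<Rightarrow> bool" where
  "charts t T g \<longleftrightarrow> boron_tree T \<and> bij_betw g (set_btree t) (hydrogens T) \<and>
     (\<forall>w\<in>set_btree t. \<forall>x\<in>set_btree t. \<forall>y\<in>set_btree t. \<forall>z\<in>set_btree t.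
       leaf_rho t w x y z \<longleftrightarrow> rho T (g w) (g x) (g y) (g z))"

text \<open>
  The leaves of a binary tree for \<open>T\<close> are numbered from left to right, and \<open>g\<close> sends a number to the leaf
  at that position.
\<close>

lemma boron_tree_chart:
  assumes "boron_tree T"
  shows "\<exists>t g. sorted_wrt (<) (leaves t) \<and> charts t T g"
proof -
  from boron_tree_btree[OF assms] obtain t where t: "distinct (leaves t)" "set_btree t = hydrogens T"
    and rho: "\<forall>w\<in>hydrogens T. \<forall>x\<in>hydrogens T. \<forall>y\<in>hydrogens T. \<forall>z\<in>hydrogens T.
      rho T w x y z \<longleftrightarrow> leaf_rho t w x y z"
    by (elim exE conjE)
  define n where "n = length (leaves t)"
  define g where "g i = leaves t ! i" for i
  have g: "bij_betw g {..<n} (set_btree t)"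
    unfolding n_def g_def using bij_betw_nth[OF t(1) refl, of "set_btree t"] by simp
  define h where "h = inv_into {..<n} g"
  have gh: "g (h x) = x" if "x \<in> set_btree t" for x
    using that g unfolding h_def by (simp add: bij_betw_inv_into_right)
  have hg: "h (g i) = i" if "i < n" for i
    using that g unfolding h_def by (simp add: bij_betw_inv_into_left)
  have hinj: "inj_on h (set_btree t)" using gh by (rule inj_on_inverseI)
  let ?t = "map_btree h t"
  have lv: "leaves ?t = [0..<n]"
    by (rule nth_equalityI) (use hg in \<open>simp_all add: leaves_map n_def g_def\<close>)
  then have st: "set_btree ?t = {..<n}" by (metis atLeast0LessThan set_leaves set_upt)
  have "sorted_wrt (<) (leaves ?t)" by (simp add: lv)
  moreover have "charts ?t T g"
    unfolding charts_def st
  proof (intro conjI ballI)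
    show "boron_tree T" by fact
    show "bij_betw g {..<n} (hydrogens T)" using g t(2) by simp
    fix w x y z assume i: "w \<in> {..<n}" "x \<in> {..<n}" "y \<in> {..<n}" "z \<in> {..<n}"
    then have H: "g w \<in> set_btree t" "g x \<in> set_btree t" "g y \<in> set_btree t" "g z \<in> set_btree t"
      using bij_betwE[OF g] by blast+
    have "leaf_rho ?t w x y z \<longleftrightarrow> leaf_rho t (g w) (g x) (g y) (g z)"
      using leaf_rho_map[OF hinj H] i by (simp add: hg)
    then show "leaf_rho ?t w x y z \<longleftrightarrow> rho T (g w) (g x) (g y) (g z)"
      using rho H unfolding t(2) by blast
  qed
  ultimately show ?thesis by blast
qed

lemma chart_transport:
  assumes s: "charts (tree_of k) T g" and t: "charts (tree_of l) T' g'"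
    and f: "f \<in> str_hom leaf_set leaf_val k l"
  shows "(\<lambda>v\<in>hydrogens T. g' (f (inv_into (leaf_set k) g v))) \<in> str_hom hydrogens rho T T'"
proof -
  let ?i = "inv_into (leaf_set k) g"
  have g: "bij_betw g (leaf_set k) (hydrogens T)" and g': "bij_betw g' (leaf_set l) (hydrogens T')"
    using s t by (auto simp: charts_def leaf_set_def)
  have i: "bij_betw ?i (hydrogens T) (leaf_set k)" by (rule bij_betw_inv_into[OF g])
  have f': "f \<in> leaf_set k \<rightarrow> leaf_set l" "inj_on f (leaf_set k)" using f by (auto simp: str_hom_def)
  have H: "?i v \<in> leaf_set k" "f (?i v) \<in> leaf_set l" "g' (f (?i v)) \<in> hydrogens T'" "g (?i v) = v"
    if "v \<in> hydrogens T" for v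
  proof -
    show a: "?i v \<in> leaf_set k" using bij_betwE[OF i] that by blast
    then show b: "f (?i v) \<in> leaf_set l" using f' by blast
    then show "g' (f (?i v)) \<in> hydrogens T'" using bij_betwE[OF g'] by blast
    show "g (?i v) = v" by (rule bij_betw_inv_into_right[OF g that])
  qed
  have "inj_on (\<lambda>v. g' (f (?i v))) (hydrogens T)"
  proof (rule inj_onI)
    fix u v assume uv: "u \<in> hydrogens T" "v \<in> hydrogens T" "g' (f (?i u)) = g' (f (?i v))"
    then have "f (?i u) = f (?i v)" using bij_betw_imp_inj_on[OF g'] H(2) by (meson inj_onD)
    then have "?i u = ?i v" using f'(2) H(1) uv by (meson inj_onD)
    then show "u = v" using H(4) uv by metis
  qed
  moreover have "rho T w x y z \<longleftrightarrow> rho T' (g' (f (?i w))) (g' (f (?i x))) (g' (f (?i y))) (g' (f (?i z)))"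
    if "w \<in> hydrogens T" "x \<in> hydrogens T" "y \<in> hydrogens T" "z \<in> hydrogens T" for w x y z
  proof -
    note h = H[OF that(1)] H[OF that(2)] H[OF that(3)] H[OF that(4)]
    have "rho T w x y z \<longleftrightarrow> leaf_rho (tree_of k) (?i w) (?i x) (?i y) (?i z)"
      using s h unfolding charts_def leaf_set_def by metis
    also have "\<dots> \<longleftrightarrow> leaf_rho (tree_of l) (f (?i w)) (f (?i x)) (f (?i y)) (f (?i z))"
      using f h by (simp add: str_hom_def leaf_val_def)
    also have "\<dots> \<longleftrightarrow> rho T' (g' (f (?i w))) (g' (f (?i x))) (g' (f (?i y))) (g' (f (?i z)))"
      using t h unfolding charts_def leaf_set_def by metis
    finally show ?thesis .
  qed
  ultimately show ?thesis using H(3) by (simp add: str_hom_def inj_on_restrict_eq)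
qed

text \<open>
  A chosen boron tree \<open>\<Phi> k\<close> for each binary tree, with an identification \<open>\<eta> k\<close> of the leaves. Morphisms
  are conjugated by these identifications, which makes \<open>\<eta>\<close> natural.
\<close>

definition chart_functor ::
  "(nat \<Rightarrow> 'v sgraph) \<Rightarrow> (nat \<Rightarrow> nat \<Rightarrow> 'v) \<Rightarrow> (nat, nat, 'v sgraph, 'v \<Rightarrow> 'v) functr" where
  "chart_functor \<Phi> \<eta> = \<lparr> obj_map = \<Phi>,
     mor_map = (\<lambda>k l m. \<lambda>v\<in>hydrogens (\<Phi> k). \<eta> l (leaf_dec k m (inv_into (leaf_set k) (\<eta> k) v))) \<rparr>"

lemma chart_functor_concrete:
  assumes chart: "\<And>t. t \<in> S \<Longrightarrow> charts t (\<Phi> (to_nat t)) (\<eta> (to_nat t))"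
  shows "concrete_functor (leaf_category S) leaf_functor boron_category hydrogen_functor
    (chart_functor \<Phi> \<eta>) \<eta>"
proof -
  let ?D = "leaf_category S" and ?F = "chart_functor \<Phi> \<eta>"
  have ch: "charts (tree_of k) (\<Phi> k) (\<eta> k)" if "k \<in> Ob ?D" for k
  proof -
    have "k \<in> to_nat ` S" using that by (simp add: leaf_category_def str_category_def)
    then obtain t where "k = to_nat t" "t \<in> S" by (rule imageE)
    then show ?thesis using chart[of t] by simp
  qed
  have bij: "bij_betw (\<eta> k) (leaf_set k) (hydrogens (\<Phi> k))" if "k \<in> Ob ?D" for k
    using ch[OF that] by (simp add: charts_def leaf_set_def)
  have inv: "inv_into (leaf_set k) (\<eta> k) v \<in> leaf_set k" if "k \<in> Ob ?D" "v \<in> hydrogens (\<Phi> k)" for k v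
    using bij_betwE[OF bij_betw_inv_into[OF bij[OF that(1)]]] that(2) by blast
  have inv_left: "inv_into (leaf_set k) (\<eta> k) (\<eta> k x) = x" if "k \<in> Ob ?D" "x \<in> leaf_set k" for k x
    by (rule bij_betw_inv_into_left[OF bij[OF that(1)] that(2)])
  have inv_right: "\<eta> k (inv_into (leaf_set k) (\<eta> k) v) = v" if "k \<in> Ob ?D" "v \<in> hydrogens (\<Phi> k)" for k v
    by (rule bij_betw_inv_into_right[OF bij[OF that(1)] that(2)])
  have dec_closed: "leaf_dec k m x \<in> leaf_set l" if "m \<in> Hom ?D k l" "x \<in> leaf_set k" for k l m x
    using leaf_hom_dec[OF that(1)] that(2) by (auto simp: str_hom_def)
  have mor: "mor_map ?F k l m v = \<eta> l (leaf_dec k m (inv_into (leaf_set k) (\<eta> k) v))"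
    if "v \<in> hydrogens (\<Phi> k)" for k l m v
    using that by (simp add: chart_functor_def)
  have "is_functor ?D boron_category ?F"
    unfolding is_functor_def
  proof (intro conjI ballI)
    show "obj_map ?F k \<in> Ob boron_category" if "k \<in> Ob ?D" for k
      using ch[OF that] by (simp add: charts_def chart_functor_def boron_category_def)
    show "mor_map ?F k l m \<in> Hom boron_category (obj_map ?F k) (obj_map ?F l)"
      if "k \<in> Ob ?D" "l \<in> Ob ?D" "m \<in> Hom ?D k l" for k l m
      using chart_transport[OF ch[OF that(1)] ch[OF that(2)] leaf_hom_dec[OF that(3)]]
      by (simp add: boron_category_eq str_category_def chart_functor_def)
    show "mor_map ?F k k (Ident ?D k) = Ident boron_category (obj_map ?F k)" if "k \<in> Ob ?D" for k
    proof -
      have "leaf_dec k (Ident ?D k) = (\<lambda>x\<in>leaf_set k. x)"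
        by (simp add: leaf_category_def str_category_def leaf_dec_enc)
      then show ?thesis
        using inv[OF that] inv_right[OF that]
        by (auto simp: chart_functor_def boron_category_def intro!: restrict_ext)
    qed
    show "mor_map ?F k n (Comp ?D k l n m' m) =
        Comp boron_category (obj_map ?F k) (obj_map ?F l) (obj_map ?F n) (mor_map ?F l n m') (mor_map ?F k l m)"
      if "k \<in> Ob ?D" "l \<in> Ob ?D" "n \<in> Ob ?D" "m \<in> Hom ?D k l" "m' \<in> Hom ?D l n" for k l n m m'
    proof -
      have dec: "leaf_dec k (Comp ?D k l n m' m) = compose (leaf_set k) (leaf_dec l m') (leaf_dec k m)"
        unfolding leaf_category_def str_category_def category.simps
        by (rule leaf_dec_enc) (rule compose_extensional)
      show ?thesis
      proof
        fix v
        show "mor_map ?F k n (Comp ?D k l n m' m) v = Comp boron_category (obj_map ?F k) (obj_map ?F l)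
            (obj_map ?F n) (mor_map ?F l n m') (mor_map ?F k l m) v"
        proof (cases "v \<in> hydrogens (\<Phi> k)")
          case True
          let ?x = "inv_into (leaf_set k) (\<eta> k) v"
          have x: "?x \<in> leaf_set k" "leaf_dec k m ?x \<in> leaf_set l"
            using inv[OF that(1) True] dec_closed[OF that(4)] by blast+
          have y: "\<eta> l (leaf_dec k m ?x) \<in> hydrogens (\<Phi> l)"
            using bij_betwE[OF bij[OF that(2)]] x(2) by blast
          show ?thesis
            using True x y inv_left[OF that(2) x(2)]
            by (simp add: chart_functor_def boron_category_def dec compose_def)
        next
          case False
          then show ?thesis by (simp add: chart_functor_def boron_category_def compose_def)
        qed
      qed
    qed
  qed
  moreover have "bij_betw (\<eta> k) (obj_map leaf_functor k) (obj_map hydrogen_functor (obj_map ?F k))"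
    if "k \<in> Ob ?D" for k
    using bij[OF that] by (simp add: leaf_functor_def str_functor_def hydrogen_functor_def chart_functor_def)
  moreover have "\<eta> l (mor_map leaf_functor k l m x) =
      mor_map hydrogen_functor (obj_map ?F k) (obj_map ?F l) (mor_map ?F k l m) (\<eta> k x)"
    if "k \<in> Ob ?D" "l \<in> Ob ?D" "m \<in> Hom ?D k l" "x \<in> obj_map leaf_functor k" for k l m x
  proof -
    have x: "x \<in> leaf_set k" using that(4) by (simp add: leaf_functor_def str_functor_def)
    then have "\<eta> k x \<in> hydrogens (\<Phi> k)" using bij_betwE[OF bij[OF that(1)]] by blast
    then show ?thesis
      using inv_left[OF that(1) x]
      by (simp add: leaf_functor_def str_functor_def hydrogen_functor_def mor)
  qed
  ultimately show ?thesis unfolding concrete_functor_def by blast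
qed

text \<open>
  Hence it does not matter which boron tree the functor picks for a binary tree.
\<close>

lemma charts_isomorphic:
  fixes T T' :: "'v sgraph"
  assumes "charts t T g" "charts t T' g'"
  shows "isomorphic boron_category T T'"
proof -
  have *: "charts (tree_of (to_nat t)) T g" "charts (tree_of (to_nat t)) T' g'" using assms by simp_all
  let ?k = "to_nat t"
  let ?id = "\<lambda>x\<in>leaf_set ?k. x"
  define tr where "tr g T g' = (\<lambda>v\<in>hydrogens T. g' (?id (inv_into (leaf_set ?k) g v)))" for g g' :: "nat \<Rightarrow> 'v" and T :: "'v sgraph"
  have hom: "tr g T g' \<in> str_hom hydrogens rho T T'"
    if "charts (tree_of ?k) T g" "charts (tree_of ?k) T' g'" for T T' :: "'v sgraph" and g g'
    unfolding tr_def by (rule chart_transport[OF that str_hom_id])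
  have inv: "compose (hydrogens T) (tr g' T' g) (tr g T g') = (\<lambda>v\<in>hydrogens T. v)"
    if "charts (tree_of ?k) T g" "charts (tree_of ?k) T' g'" for T T' :: "'v sgraph" and g g'
  proof
    fix v
    have g: "bij_betw g (leaf_set ?k) (hydrogens T)" and g': "bij_betw g' (leaf_set ?k) (hydrogens T')"
      using that by (simp_all add: charts_def leaf_set_def)
    show "compose (hydrogens T) (tr g' T' g) (tr g T g') v = (\<lambda>v\<in>hydrogens T. v) v"
    proof (cases "v \<in> hydrogens T")
      case True
      have x: "inv_into (leaf_set ?k) g v \<in> leaf_set ?k"
        using bij_betwE[OF bij_betw_inv_into[OF g]] True by blast
      then have "g' (inv_into (leaf_set ?k) g v) \<in> hydrogens T'" using bij_betwE[OF g'] by blast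
      then show ?thesis
        using True x bij_betw_inv_into_left[OF g' x] bij_betw_inv_into_right[OF g True]
        by (simp add: compose_def tr_def)
    qed (simp add: compose_def)
  qed
  have "is_iso boron_category T T' (tr g T g')"
    unfolding is_iso_def boron_category_eq str_category_def
    using hom[OF *] hom[OF *(2,1)] inv[OF *] inv[OF *(2,1)]
    by (auto intro!: bexI[of _ "tr g' T' g"])
  then show ?thesis unfolding isomorphic_def by blast
qed

theorem corollary4p4:
  shows "QG_category (boron_category :: ('v::infinite sgraph, 'v \<Rightarrow> 'v) category) hydrogen_functor"
proof -
  define S where "S = {t. sorted_wrt (<) (leaves t) \<and> (\<exists>(T :: 'v sgraph) g. charts t T g)}"
  have "\<forall>k. \<exists>(T :: 'v sgraph) g. tree_of k \<in> S \<longrightarrow> charts (tree_of k) T g"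
    unfolding S_def by blast
  then obtain \<Phi> :: "nat \<Rightarrow> 'v sgraph" and \<eta>
    where \<Phi>\<eta>: "\<And>k. tree_of k \<in> S \<Longrightarrow> charts (tree_of k) (\<Phi> k) (\<eta> k)"
    by metis
  have chart: "charts t (\<Phi> (to_nat t)) (\<eta> (to_nat t))" if "t \<in> S" for t
    using \<Phi>\<eta>[of "to_nat t"] that by simp
  have "essentially_surjective (leaf_category S) boron_category (chart_functor \<Phi> \<eta>)"
    unfolding essentially_surjective_def
  proof
    fix T :: "'v sgraph" assume "T \<in> Ob boron_category"
    then have "boron_tree T" by (simp add: boron_category_def)
    then obtain t g where t: "sorted_wrt (<) (leaves t)" "charts t T g" using boron_tree_chart by blast
    then have "t \<in> S" by (auto simp: S_def)
    then have "isomorphic boron_category (\<Phi> (to_nat t)) T" by (rule charts_isomorphic[OF chart t(2)])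
    then show "\<exists>k\<in>Ob (leaf_category S). isomorphic boron_category (obj_map (chart_functor \<Phi> \<eta>) k) T"
      using \<open>t \<in> S\<close> by (auto simp: leaf_category_def str_category_def chart_functor_def)
  qed
  moreover have "G_category (leaf_category S) leaf_functor"
    by (rule G_category_leaf_category) (simp add: S_def)
  ultimately show ?thesis
    unfolding QG_category_def using FI_concrete_boron chart_functor_concrete[of S \<Phi> \<eta>, OF chart] by blast
qed

end
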